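(* Let $\mathcal{G}$ be the planar Galilean conformal algebra. Let $\boldsymbol{m}=(m_1,m_2),\boldsymbol{n}=(n_1,n_2)\in\mathbb{N}^2$; let $\boldsymbol{\lambda}=(\lambda_1,\ldots,\lambda_{m_1+m_2}),\boldsymbol{\sigma}=(\sigma_1,\ldots,\sigma_{m_1+m_2})\in(\mathbb{C}^* )^{m_1+m_2}$, $\boldsymbol{\eta}=(\eta_1,\ldots,\eta_{m_1+m_2})\in\mathbb{C}^{m_1+m_2}$, with $\lambda_1,\ldots,\lambda_{m_1+m_2}$ pairwise distinct; let $\boldsymbol{\mu}=(\mu_1,\ldots,\mu_{n_1+n_2}),\boldsymbol{\tau}=(\tau_1,\ldots,\tau_{n_1+n_2})\in(\mathbb{C}^* )^{n_1+n_2}$, $\boldsymbol{\gamma}=(\gamma_1,\ldots,\gamma_{n_1+n_2})\in\mathbb{C}^{n_1+n_2}$, with $\mu_1,\ldots,\mu_{n_1+n_2}$ pairwise distinct; and let $V$ and $W$ be simple restricted $\mathcal{G}$-modules. Then the (simple) tensor product $\mathcal{G}$-modules $$\boldsymbol{T}(\boldsymbol{m},\boldsymbol{\lambda},\boldsymbol{\sigma},\boldsymbol{\eta},V)=\left(\bigotimes_{k=1}^{m_1}\Omega(\lambda_k,\sigma_k,\eta_k)\right)\otimes\left(\bigotimes_{k=m_1+1}^{m_1+m_2}\Gamma(\lambda_k,\sigma_k,\eta_k)\right)\otimes V$$ and $$\boldsymbol{T}(\boldsymbol{n},\boldsymbol{\mu},\boldsymbol{\tau},\boldsymbol{\gamma},W)=\left(\bigotimes_{k=1}^{n_1}\Omega(\mu_k,\tau_k,\gamma_k)\right)\otimes\left(\bigotimes_{k=n_1+1}^{n_1+n_2}\Gamma(\mu_k,\tau_k,\gamma_k)\right)\otimes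 W$$ are isomorphic as $\mathcal{G}$-modules if and only if $\boldsymbol{m}=\boldsymbol{n}$, $V\cong W$ as $\mathcal{G}$-modules, and $$\{(\lambda_k,\sigma_k,\eta_k)\mid 1\le k\le m_1\}=\{(\mu_k,\tau_k,\gamma_k)\mid 1\le k\le m_1\},$$ $$\{(\lambda_k,\sigma_k,\eta_k)\mid m_1+1\le k\le m_1+m_2\}=\{(\mu_k,\tau_k,\gamma_k)\mid m_1+1\le k\le m_1+m_2\}.$$
   Context: $\mathbb{N}$ is the set of non-negative integers and $\mathbb{C}^*$ the set of non-zero complex numbers. All tensor products are over $\mathbb{C}$. The planar Galilean conformal algebra $\mathcal{G}$ is the complex Lie algebra with basis $\{L_n,H_n,I_n,J_n\mid n\in\mathbb{Z}\}$ and non-trivial brackets $$[L_m,L_n]=(n-m)L_{m+n},\quad [L_m,H_n]=nH_{m+n},\quad [L_m,I_n]=(n-m)I_{m+n},$$ $$[L_m,J_n]=(n-m)J_{m+n},\quad [H_m,I_n]=I_{m+n},\quad [H_m,J_n]=-J_{m+n}$$ (all other brackets of basis elements, apart from those obtained by antisymmetry, are zero). It is $\mathbb{Z}$-graded with $\mathcal{G}_n=\mathbb{C}L_n\oplus\mathbb{C}H_n\oplus\mathbb{C}I_n\oplus\mathbb{C}J_n$. A $\mathcal{G}$-module $V$ is restricted if for every $v\in V$ there is $i\in\mathbb{N}$ such that $\mathcal{G}_nv=0$ for all $n\ge i$. For $\eta\in\mathbb{C}$ and $\lambda,\sigma\in\mathbb{C}^*$, the $\mathcal{G}$-module $\Omega(\lambda,\sigma,\eta)$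 is the vector space $\mathbb{C}[s,t]$ with actions, for $n\in\mathbb{Z}$ and $f\in\mathbb{C}[s,t]$, $$L_nf(s,t)=\lambda^n(s-nt+n\eta)f(s-n,t),\quad H_nf(s,t)=\lambda^n t f(s-n,t),\quad I_nf(s,t)=\lambda^n\sigma f(s-n,t-1),\quad J_nf(s,t)=0.$$ The $\mathcal{G}$-module $\Gamma(\lambda,\sigma,\eta)$ is the vector space $\mathbb{C}[x,y]$ with actions, for $n\in\mathbb{Z}$ and $g\in\mathbb{C}[x,y]$, $$L_ng(x,y)=\lambda^n(x+ny+n\eta)g(x-n,y),\quad H_ng(x,y)=\lambda^n y g(x-n,y),\quad I_ng(x,y)=0,\quad J_ng(x,y)=\lambda^n\sigma g(x-n,y+1).$$ The tensor product of Lie algebra modules carries the usual action $x(m_1\otimes\cdots\otimes m_r)=\sum_{i}m_1\otimes\cdots\otimes(xm_i)\otimes\cdots\otimes m_r$; if a range of indices is empty, the corresponding factors are absent. The tensor product modules above are simple exactly when the parameters $\lambda_k$ (respectively $\mu_k$) are pairwise distinct. *)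

theory Defs
  imports Complex_Main "HOL-Library.Poly_Mapping" "HOL-Computational_Algebra.Polynomial"
begin

section \<open>Free complex vector spaces\<close>

definition pm_scale :: "complex \<Rightarrow> ('k \<Rightarrow>\<^sub>0 complex) \<Rightarrow> ('k \<Rightarrow>\<^sub>0 complex)" where
  "pm_scale c p = Poly_Mapping.map ((*) c) p"

lemma lookup_pm_scale [simp]: "Poly_Mapping.lookup (pm_scale c p) k = c * Poly_Mapping.lookup p k"
  by (simp add: pm_scale_def Poly_Mapping.map.rep_eq when_def)

global_interpretation pm: vector_space "pm_scale :: complex \<Rightarrow> ('k \<Rightarrow>\<^sub>0 complex) \<Rightarrow> _"
  by unfold_locales (rule poly_mapping_eqI, simp add: lookup_add algebra_simps)+

text \<open>The linear extension of a map given on the basis.\<close>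
definition lin_ext ::
  "(complex \<Rightarrow> 'b \<Rightarrow> 'b) \<Rightarrow> ('k \<Rightarrow> 'b) \<Rightarrow> ('k \<Rightarrow>\<^sub>0 complex) \<Rightarrow> 'b::ab_group_add" where
  "lin_ext scale g p = (\<Sum>k\<in>Poly_Mapping.keys p. scale (Poly_Mapping.lookup p k) (g k))"


section \<open>The planar Galilean conformal algebra\<close>

text \<open>Elements are finite linear combinations of the basis elements
  \<open>L\<^sub>n, H\<^sub>n, I\<^sub>n, J\<^sub>n\<close>, written \<open>Lb n, Hb n, Ib n, Jb n\<close>.\<close>

datatype gca_basis = Lb int | Hb int | Ib int | Jb int

type_synonym gca = "gca_basis \<Rightarrow>\<^sub>0 complex"

fun gca_basis_bracket :: "gca_basis \<Rightarrow> gca_basis \<Rightarrow> gca" where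
  "gca_basis_bracket (Lb m) (Lb n) = Poly_Mapping.single (Lb (m + n)) (of_int (n - m))"
| "gca_basis_bracket (Lb m) (Hb n) = Poly_Mapping.single (Hb (m + n)) (of_int n)"
| "gca_basis_bracket (Lb m) (Ib n) = Poly_Mapping.single (Ib (m + n)) (of_int (n - m))"
| "gca_basis_bracket (Lb m) (Jb n) = Poly_Mapping.single (Jb (m + n)) (of_int (n - m))"
| "gca_basis_bracket (Hb m) (Ib n) = Poly_Mapping.single (Ib (m + n)) 1"
| "gca_basis_bracket (Hb m) (Jb n) = - Poly_Mapping.single (Jb (m + n)) 1"
| "gca_basis_bracket (Hb n) (Lb m) = - Poly_Mapping.single (Hb (m + n)) (of_int n)"
| "gca_basis_bracket (Ib n) (Lb m) = - Poly_Mapping.single (Ib (m + n)) (of_int (n - m))"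
| "gca_basis_bracket (Jb n) (Lb m) = - Poly_Mapping.single (Jb (m + n)) (of_int (n - m))"
| "gca_basis_bracket (Ib n) (Hb m) = - Poly_Mapping.single (Ib (m + n)) 1"
| "gca_basis_bracket (Jb n) (Hb m) = Poly_Mapping.single (Jb (m + n)) 1"
| "gca_basis_bracket _ _ = 0"

definition gca_bracket :: "gca \<Rightarrow> gca \<Rightarrow> gca" where
  "gca_bracket x y = lin_ext pm_scale (\<lambda>a. lin_ext pm_scale (gca_basis_bracket a) y) x"

definition gca_graded :: "int \<Rightarrow> gca set" where
  "gca_graded n = pm.span ((\<lambda>b. Poly_Mapping.single b 1) ` {Lb n, Hb n, Ib n, Jb n})"


section \<open>Modules over the algebra\<close>

text \<open>A module is given by a type carrying a complex vector space structure together with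
  a bilinear action.\<close>

locale gca_module = vector_space scale
  for scale :: "complex \<Rightarrow> 'v::ab_group_add \<Rightarrow> 'v" +
  fixes act :: "gca \<Rightarrow> 'v \<Rightarrow> 'v"
  assumes linear_left: "Vector_Spaces.linear pm_scale scale (\<lambda>x. act x v)"
    and linear_right: "Vector_Spaces.linear scale scale (act x)"
    and act_bracket: "act (gca_bracket x y) v = act x (act y v) - act y (act x v)"

definition simple_gca_module ::
  "(complex \<Rightarrow> 'v::ab_group_add \<Rightarrow> 'v) \<Rightarrow> (gca \<Rightarrow> 'v \<Rightarrow> 'v) \<Rightarrow> bool" where
  "simple_gca_module scale act \<longleftrightarrow>
     gca_module scale act \<and> (\<exists>v::'v. v \<noteq> 0) \<and>
     (\<forall>U. module.subspace scale U \<and> (\<forall>x. \<forall>u\<in>U. act x u \<in> U) \<longrightarrow> U = {0} \<or> U = UNIV)"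

definition restricted_gca_module ::
  "(complex \<Rightarrow> 'v::ab_group_add \<Rightarrow> 'v) \<Rightarrow> (gca \<Rightarrow> 'v \<Rightarrow> 'v) \<Rightarrow> bool" where
  "restricted_gca_module scale act \<longleftrightarrow>
     gca_module scale act \<and>
     (\<forall>v. \<exists>i::nat. \<forall>n\<ge>int i. \<forall>x\<in>gca_graded n. act x v = 0)"

text \<open>Tensor products live on a set of cosets rather than on a full type, so isomorphisms are
  formulated for structures with an explicit carrier.\<close>

record 'v gca_struct =
  car :: "'v set"
  add :: "'v \<Rightarrow> 'v \<Rightarrow> 'v"
  scal :: "complex \<Rightarrow> 'v \<Rightarrow> 'v"
  action :: "gca \<Rightarrow> 'v \<Rightarrow> 'v"

definition type_struct ::
  "(complex \<Rightarrow> 'v::ab_group_add \<Rightarrow> 'v) \<Rightarrow> (gca \<Rightarrow> 'v \<Rightarrow> 'v) \<Rightarrow> 'v gca_struct" where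
  "type_struct scale act = \<lparr>car = UNIV, add = (+), scal = scale, action = act\<rparr>"

definition gca_iso :: "'v gca_struct \<Rightarrow> 'w gca_struct \<Rightarrow> bool" where
  "gca_iso M N \<longleftrightarrow> (\<exists>f. bij_betw f (car M) (car N) \<and>
     (\<forall>u\<in>car M. \<forall>v\<in>car M. f (add M u v) = add N (f u) (f v)) \<and>
     (\<forall>c. \<forall>v\<in>car M. f (scal M c v) = scal N c (f v)) \<and>
     (\<forall>x. \<forall>v\<in>car M. f (action M x v) = action N x (f v)))"


section \<open>The modules \<open>\<Omega>\<close> and \<open>\<Gamma>\<close>\<close>

text \<open>A polynomial in two variables is an element of \<open>\<complex>[s][t]\<close>: the coefficients of the outer
  polynomial (in \<open>t\<close>, resp. \<open>y\<close>) are polynomials in \<open>s\<close>, resp. \<open>x\<close>.\<close>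

type_synonym poly2 = "complex poly poly"

definition poly2_scale :: "complex \<Rightarrow> poly2 \<Rightarrow> poly2" where
  "poly2_scale c f = smult [:c:] f"

abbreviation const2 :: "complex \<Rightarrow> poly2" where "const2 c \<equiv> [:[:c:]:]"
abbreviation var1 :: poly2 where "var1 \<equiv> [:[:0, 1:]:]"
abbreviation var2 :: poly2 where "var2 \<equiv> [:0, 1:]"

text \<open>\<open>shift2 a b f\<close> is \<open>f(s + a, t + b)\<close>.\<close>
definition shift2 :: "complex \<Rightarrow> complex \<Rightarrow> poly2 \<Rightarrow> poly2" where
  "shift2 a b f = pcompose (map_poly (\<lambda>p. pcompose p [:a, 1:]) f) [:[:b:], 1:]"

fun Omega_basis :: "complex \<Rightarrow> complex \<Rightarrow> complex \<Rightarrow> poly2 \<Rightarrow> gca_basis \<Rightarrow> poly2" where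
  "Omega_basis lam sig eta f (Lb n) = poly2_scale (lam powi n)
     ((var1 - of_int n * var2 + const2 (of_int n * eta)) * shift2 (- of_int n) 0 f)"
| "Omega_basis lam sig eta f (Hb n) = poly2_scale (lam powi n) (var2 * shift2 (- of_int n) 0 f)"
| "Omega_basis lam sig eta f (Ib n) =
     poly2_scale (lam powi n * sig) (shift2 (- of_int n) (-1) f)"
| "Omega_basis lam sig eta f (Jb n) = 0"

definition Omega :: "complex \<Rightarrow> complex \<Rightarrow> complex \<Rightarrow> gca \<Rightarrow> poly2 \<Rightarrow> poly2" where
  "Omega lam sig eta x f = lin_ext poly2_scale (Omega_basis lam sig eta f) x"

fun Gamma_basis :: "complex \<Rightarrow> complex \<Rightarrow> complex \<Rightarrow> poly2 \<Rightarrow> gca_basis \<Rightarrow> poly2" where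
  "Gamma_basis lam sig eta g (Lb n) = poly2_scale (lam powi n)
     ((var1 + of_int n * var2 + const2 (of_int n * eta)) * shift2 (- of_int n) 0 g)"
| "Gamma_basis lam sig eta g (Hb n) = poly2_scale (lam powi n) (var2 * shift2 (- of_int n) 0 g)"
| "Gamma_basis lam sig eta g (Ib n) = 0"
| "Gamma_basis lam sig eta g (Jb n) =
     poly2_scale (lam powi n * sig) (shift2 (- of_int n) 1 g)"

definition Gamma :: "complex \<Rightarrow> complex \<Rightarrow> complex \<Rightarrow> gca \<Rightarrow> poly2 \<Rightarrow> poly2" where
  "Gamma lam sig eta x g = lin_ext poly2_scale (Gamma_basis lam sig eta g) x"


section \<open>Tensor products\<close>

text \<open>The tensor product \<open>A \<otimes> \<dots> \<otimes> A \<otimes> V\<close> with \<open>r\<close> factors \<open>A\<close> is the quotient of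
  the free vector space on the tuples \<open>([a\<^sub>1, \<dots>, a\<^sub>r], v)\<close> by the multilinearity relations.
  The \<open>r\<close> factors share the underlying vector space \<open>A\<close> but not the module structure.\<close>

definition tensor_free :: "nat \<Rightarrow> ('a list \<times> 'v \<Rightarrow>\<^sub>0 complex) set" where
  "tensor_free r = {p. \<forall>(as, v)\<in>Poly_Mapping.keys p. length as = r}"

abbreviation gen :: "'a list \<Rightarrow> 'v \<Rightarrow> ('a list \<times> 'v \<Rightarrow>\<^sub>0 complex)" where
  "gen as v \<equiv> Poly_Mapping.single (as, v) 1"

definition tensor_relators :: "nat \<Rightarrow> (complex \<Rightarrow> 'a::ab_group_add \<Rightarrow> 'a) \<Rightarrow>
    (complex \<Rightarrow> 'v::ab_group_add \<Rightarrow> 'v) \<Rightarrow> ('a list \<times> 'v \<Rightarrow>\<^sub>0 complex) set" where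
  "tensor_relators r scaleA scaleV =
     {gen (as[i := a + b]) v - gen (as[i := a]) v - gen (as[i := b]) v | as i a b v.
        length as = r \<and> i < r} \<union>
     {gen (as[i := scaleA c a]) v - pm_scale c (gen (as[i := a]) v) | as i c a v.
        length as = r \<and> i < r} \<union>
     {gen as (v + w) - gen as v - gen as w | as v w. length as = r} \<union>
     {gen as (scaleV c v) - pm_scale c (gen as v) | as c v. length as = r}"

definition tensor_eq :: "nat \<Rightarrow> (complex \<Rightarrow> 'a::ab_group_add \<Rightarrow> 'a) \<Rightarrow>
    (complex \<Rightarrow> 'v::ab_group_add \<Rightarrow> 'v) \<Rightarrow> ('a list \<times> 'v \<Rightarrow>\<^sub>0 complex) rel" where
  "tensor_eq r scaleA scaleV =
     {(p, q). p \<in> tensor_free r \<and> q \<in> tensor_free r \<and>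
        p - q \<in> pm.span (tensor_relators r scaleA scaleV)}"

text \<open>The Leibniz action on the free vector space, for factor actions \<open>acts\<close> and \<open>actV\<close>.\<close>
definition tensor_free_act :: "(gca \<Rightarrow> 'a \<Rightarrow> 'a) list \<Rightarrow> (gca \<Rightarrow> 'v \<Rightarrow> 'v) \<Rightarrow> gca \<Rightarrow>
    ('a list \<times> 'v \<Rightarrow>\<^sub>0 complex) \<Rightarrow> ('a list \<times> 'v \<Rightarrow>\<^sub>0 complex)" where
  "tensor_free_act acts actV x =
     lin_ext pm_scale (\<lambda>(as, v).
       (\<Sum>i<length acts. gen (as[i := (acts ! i) x (as ! i)]) v) + gen as (actV x v))"

definition gca_tensor :: "(complex \<Rightarrow> 'a::ab_group_add \<Rightarrow> 'a) \<Rightarrow> (gca \<Rightarrow> 'a \<Rightarrow> 'a) list \<Rightarrow>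
    (complex \<Rightarrow> 'v::ab_group_add \<Rightarrow> 'v) \<Rightarrow> (gca \<Rightarrow> 'v \<Rightarrow> 'v) \<Rightarrow>
    ('a list \<times> 'v \<Rightarrow>\<^sub>0 complex) set gca_struct" where
  "gca_tensor scaleA acts scaleV actV =
     (let r = length acts; E = tensor_eq r scaleA scaleV in
      \<lparr>car = tensor_free r // E,
       add = (\<lambda>X Y. \<Union>p\<in>X. \<Union>q\<in>Y. E `` {p + q}),
       scal = (\<lambda>c X. \<Union>p\<in>X. E `` {pm_scale c p}),
       action = (\<lambda>x X. \<Union>p\<in>X. E `` {tensor_free_act acts actV x p})\<rparr>)"

definition T_module :: "nat \<times> nat \<Rightarrow> (nat \<Rightarrow> complex) \<Rightarrow> (nat \<Rightarrow> complex) \<Rightarrow> (nat \<Rightarrow> complex) \<Rightarrow>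
    (complex \<Rightarrow> 'v::ab_group_add \<Rightarrow> 'v) \<Rightarrow> (gca \<Rightarrow> 'v \<Rightarrow> 'v) \<Rightarrow>
    (poly2 list \<times> 'v \<Rightarrow>\<^sub>0 complex) set gca_struct" where
  "T_module m lam sig eta scaleV actV =
     gca_tensor poly2_scale
       (map (\<lambda>k. Omega (lam k) (sig k) (eta k)) [1..<fst m + 1] @
        map (\<lambda>k. Gamma (lam k) (sig k) (eta k)) [fst m + 1..<fst m + snd m + 1])
       scaleV actV"

end

theory Submission
  imports Defs
begin

text \<open>The idea is to realise the tensor product as a space of functions.  Evaluating polynomials
  identifies it with the space of polynomial functions \<open>F\<close> of points
  \<open>z = ((s\<^sub>1, t\<^sub>1), \<dots>, (s\<^sub>r, t\<^sub>r))\<close> with values in \<open>V\<close> (\<open>tensor_eq_iff_eval\<close>, \<open>tensor_eval_image\<close>,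
  \<open>tensor_iso_fun_struct\<close>).  An algebra element \<open>X\<^sub>n\<close> of degree \<open>n\<close> then acts by
  \<open>(X\<^sub>n F)(z) = (\<Sum>\<^sub>i \<lambda>\<^sub>i\<^sup>n c\<^sub>i(n, z\<^sub>i) F(z shifted in the i-th coordinate)) + X\<^sub>n(F(z))\<close>, where the coefficient
  \<open>c\<^sub>i\<close> and the shift are polynomial in \<open>n\<close>.

  Let \<open>f\<close> be an isomorphism of two such modules.  As \<open>V\<close> and \<open>W\<close> are restricted, the last term vanishes for
  large \<open>n\<close>, and both \<open>f(X\<^sub>n F)\<close> and \<open>X\<^sub>n f(F)\<close> are sums of exponentials times polynomials in \<open>n\<close>.  By the
  independence of exponential polynomials the parts belonging to the same base agree, and they agree as
  polynomials.  Hence \<open>f\<close> intertwines the operators on the single factors, even with an arbitrary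
  complex number in place of \<open>n\<close> (\<open>intertwine\<close>).  The operators of \<open>H\<^sub>0\<close> show that the same bases
  \<open>\<lambda>\<^sub>i\<close> occur on both sides, and those of \<open>I\<close> and \<open>J\<close> that matching factors are of the same type.
  Next, on functions that are constant with value \<open>v\<close>, the operator of \<open>I\<close> (for \<open>\<Omega>\<close>) or \<open>J\<close> (for \<open>\<Gamma>\<close>)
  is the scalar \<open>\<sigma>\<^sub>i\<close>, so the image of such a function changes by a scalar under a shift of \<open>t\<^sub>i\<close> by \<open>1\<close>
  and any shift of \<open>s\<^sub>i\<close>.  Since it is a polynomial function, it is constant, and the parameters
  \<open>\<sigma>\<close> agree (\<open>match_weight\<close>, \<open>f_const\<close>).  The operators of \<open>L\<close> give the equality of the parameters
  \<open>\<eta>\<close> (\<open>match_param\<close>).  Thus \<open>f\<close> maps constants to constants, and its restriction to constants is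
  an isomorphism from \<open>V\<close> to \<open>W\<close>, because \<open>W\<close> is simple (\<open>iso_type_struct\<close>).

  Conversely, a permutation of the factors and an isomorphism \<open>\<psi>\<close> from \<open>V\<close> to \<open>W\<close> give the
  isomorphism \<open>F \<mapsto> \<psi> \<circ> F \<circ> \<pi>\<close>, where \<open>\<pi>\<close> permutes the coordinates (\<open>fun_struct_iso_reindex\<close>).\<close>

section \<open>Linear extensions from a basis\<close>

lemma lin_ext_superset:
  assumes "vector_space scale" "finite A" "Poly_Mapping.keys p \<subseteq> A"
  shows "lin_ext scale g p = (\<Sum>k\<in>A. scale (Poly_Mapping.lookup p k) (g k))"
proof -
  interpret vector_space scale by fact
  show ?thesis unfolding lin_ext_def
    using assms(2,3) by (intro sum.mono_neutral_left) (auto simp: in_keys_iff)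
qed

lemma linear_lin_ext:
  fixes scale :: "complex \<Rightarrow> 'b::ab_group_add \<Rightarrow> 'b" and g :: "'k \<Rightarrow> 'b"
  assumes "vector_space scale"
  shows "Vector_Spaces.linear pm_scale scale (lin_ext scale g)"
proof -
  interpret vector_space scale by fact
  show ?thesis
  proof (intro Vector_Spaces.linear.intro assms pm.vector_space_axioms module_hom.intro
      module_hom_axioms.intro pm.module_axioms module_axioms)
    fix p q :: "'k \<Rightarrow>\<^sub>0 complex"
    let ?A = "Poly_Mapping.keys p \<union> Poly_Mapping.keys q"
    show "lin_ext scale g (p + q) = lin_ext scale g p + lin_ext scale g q"
      using keys_add[of p q]
      by (simp add: lin_ext_superset[OF assms, of ?A] lookup_add scale_left_distrib sum.distrib)
  next
    fix c and p :: "'k \<Rightarrow>\<^sub>0 complex"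
    have "Poly_Mapping.keys (pm_scale c p) \<subseteq> Poly_Mapping.keys p"
      by (auto simp: in_keys_iff)
    then show "lin_ext scale g (pm_scale c p) = scale c (lin_ext scale g p)"
      by (simp add: lin_ext_superset[OF assms, of "Poly_Mapping.keys p"] scale_sum_right)
  qed
qed

lemma lin_ext_single:
  assumes "vector_space scale"
  shows "lin_ext scale g (Poly_Mapping.single k c) = scale c (g k)"
proof -
  interpret vector_space scale by fact
  show ?thesis by (simp add: lin_ext_superset[OF assms, of "{k}"])
qed

section \<open>Evaluation of polynomials in two variables\<close>

text \<open>The value of a polynomial at a point of \<open>\<complex>\<^sup>2\<close>: the second coordinate is substituted for
  the outer variable, the first one for the inner variable.\<close>
definition ev :: "poly2 \<Rightarrow> complex \<times> complex \<Rightarrow> complex" where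
  "ev f z = poly (poly f [:snd z:]) (fst z)"

lemma ev_simps [simp]:
  "ev 0 z = 0" "ev 1 z = 1" "ev (f + g) z = ev f z + ev g z" "ev (f - g) z = ev f z - ev g z"
  "ev (f * g) z = ev f z * ev g z" "ev (poly2_scale c f) z = c * ev f z"
  "ev (of_int n) z = of_int n" "ev (f ^ k) z = ev f z ^ k"
  "ev var1 z = fst z" "ev var2 z = snd z" "ev (const2 c) z = c"
  by (simp_all add: ev_def poly2_scale_def of_int_poly poly_power)

lemma ev_pCons: "ev (pCons p f) z = poly p (fst z) + snd z * ev f z"
  by (simp add: ev_def)

lemma ev_shift2: "ev (shift2 a b f) z = ev f (fst z + a, snd z + b)"
proof -
  have *: "poly (poly (map_poly (\<lambda>p. pcompose p [:a, 1:]) f) [:c:]) x = poly (poly f [:c:]) (x + a)"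
    for c x by (induction f) (auto simp: map_poly_pCons poly_pcompose add.commute)
  show ?thesis
    by (simp add: ev_def shift2_def poly_pcompose * add.commute)
qed

global_interpretation poly2: vector_space poly2_scale
proof unfold_locales
  show "poly2_scale (a + b) x = poly2_scale a x + poly2_scale b x" for a b x
    using smult_add_left[of "[:a:]" "[:b:]" x] by (simp add: poly2_scale_def)
qed (simp_all add: poly2_scale_def smult_add_right mult.commute flip: one_pCons)

lemma ev_sum: "ev (\<Sum>i\<in>I. f i) z = (\<Sum>i\<in>I. ev (f i) z)"
  by (induction I rule: infinite_finite_induct) auto

text \<open>The monomial \<open>s\<^sup>a t\<^sup>b\<close> with exponents \<open>e = (a, b)\<close>.\<close>
definition mono2 :: "nat \<times> nat \<Rightarrow> poly2" where
  "mono2 e = var1 ^ fst e * var2 ^ snd e"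

lemma ev_mono2: "ev (mono2 e) z = fst z ^ fst e * snd z ^ snd e"
  by (simp add: mono2_def)

lemma poly2_mono2_induct:
  assumes mon: "\<And>e. P (mono2 e)"
    and add: "\<And>f g. P f \<Longrightarrow> P g \<Longrightarrow> P (f + g)"
    and scale: "\<And>c f. P f \<Longrightarrow> P (poly2_scale c f)"
  shows "P f"
proof -
  have 0: "P 0" using scale[OF mon, of 0] by simp
  have sum: "P (\<Sum>i\<in>I. h i)" if "\<And>i. i \<in> I \<Longrightarrow> P (h i)" for h and I :: "nat set"
    using that by (induction I rule: infinite_finite_induct) (auto intro: 0 add)
  have mon': "monom (monom c a) b = poly2_scale c (mono2 (a, b))" for c a b
  proof -
    have "mono2 (a, b) = [:[:0, 1:] ^ a:] * monom 1 b"
      by (simp add: mono2_def monom_altdef poly_const_pow)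
    also have "poly2_scale c \<dots> = [: [:c:] * monom 1 a:] * monom 1 b"
      by (simp add: poly2_scale_def monom_altdef)
    also have "\<dots> = monom (monom c a) b"
      by (simp add: smult_monom)
    finally show ?thesis ..
  qed
  have "monom p b = (\<Sum>i\<le>degree p. monom (monom (coeff p i) i) b)" for p :: "complex poly" and b
    by (subst poly_as_sum_of_monoms[of p, symmetric]) (simp add: monom_sum)
  then have "P (monom p b)" for p b
    by (auto simp: mon' intro!: sum scale mon)
  then have "P (\<Sum>i\<le>degree f. monom (coeff f i) i)"
    by (intro sum)
  then show ?thesis by (simp add: poly_as_sum_of_monoms)
qed

section \<open>Independence of multiplicative characters\<close>

text \<open>The Artin--Dedekind theorem with vectors in place of scalar coefficients: distinct characters
  of a set with a multiplication \<open>m\<close> are linearly independent.  It is applied to monomials, viewed as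
  characters of the points under coordinatewise multiplication.\<close>
lemma characters_independent:
  fixes scale :: "complex \<Rightarrow> 'b::ab_group_add \<Rightarrow> 'b" and \<chi> :: "'e \<Rightarrow> 'z \<Rightarrow> complex"
  assumes "vector_space scale" "finite S"
    and mult: "\<And>e y z. \<chi> e (m y z) = \<chi> e y * \<chi> e z"
    and nz: "\<And>e. e \<in> S \<Longrightarrow> \<exists>z. \<chi> e z \<noteq> 0"
    and dist: "\<And>e e'. e \<in> S \<Longrightarrow> e' \<in> S \<Longrightarrow> e \<noteq> e' \<Longrightarrow> \<exists>z. \<chi> e z \<noteq> \<chi> e' z"
    and zero: "\<And>z. (\<Sum>e\<in>S. scale (\<chi> e z) (w e)) = 0"
    and "e \<in> S"
  shows "w e = 0"
proof -
  interpret vector_space scale by fact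
  from \<open>finite S\<close> nz dist zero \<open>e \<in> S\<close> show ?thesis
  proof (induction S arbitrary: w e rule: finite_induct)
    case (insert e0 S)
    \<comment> \<open>Subtracting \<open>\<chi> e0 y\<close> times the relation at \<open>z\<close> from the relation at \<open>m y z\<close> removes the term
      of \<open>e0\<close> and multiplies the coefficient of \<open>e1\<close> by a nonzero scalar.\<close>
    have S0: "w e1 = 0" if e1: "e1 \<in> S" for e1
    proof -
      from insert.prems(2)[of e1 e0] e1 insert.hyps obtain y where y: "\<chi> e1 y \<noteq> \<chi> e0 y"
        by auto
      let ?w = "\<lambda>e. scale (\<chi> e y - \<chi> e0 y) (w e)"
      have "(\<Sum>e\<in>S. scale (\<chi> e z) (?w e)) = 0" for z
      proof -
        have "(\<Sum>e\<in>S. scale (\<chi> e z) (?w e)) = (\<Sum>e\<in>insert e0 S. scale (\<chi> e z) (?w e))"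
          using insert.hyps by simp
        also have "\<dots> = (\<Sum>e\<in>insert e0 S. scale (\<chi> e (m y z)) (w e))
            - scale (\<chi> e0 y) (\<Sum>e\<in>insert e0 S. scale (\<chi> e z) (w e))"
          by (simp only: scale_sum_right sum_subtractf[symmetric] mult scale_scale
                scale_left_diff_distrib[symmetric]) (simp add: algebra_simps)
        finally show ?thesis by (simp only: insert.prems(3)) simp
      qed
      note w0 = this
      have "?w e1 = 0"
      proof (rule insert.IH)
        show "\<exists>z. \<chi> e z \<noteq> 0" if "e \<in> S" for e
          using insert.prems(1) that by blast
        show "\<exists>z. \<chi> e z \<noteq> \<chi> e' z" if "e \<in> S" "e' \<in> S" "e \<noteq> e'" for e e'
          using insert.prems(2) that by blast
      qed (rule w0, rule e1)
      with y show ?thesis by simp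
    qed
    obtain z where "\<chi> e0 z \<noteq> 0" using insert.prems(1) by blast
    with insert.prems(3)[of z] insert.hyps S0 have "w e0 = 0" by simp
    with S0 insert.prems(4) show ?case by auto
  qed simp
qed

section \<open>Tensors as vector-valued functions\<close>

text \<open>A point assigns a pair \<open>(s\<^sub>i, t\<^sub>i)\<close> to each tensor factor \<open>i\<close>.  With \<open>r\<close> factors only the
  coordinates \<open>i < r\<close> matter.\<close>
type_synonym point = "nat \<Rightarrow> complex \<times> complex"

text \<open>The linear map that sends \<open>a\<^sub>1 \<otimes> \<dots> \<otimes> a\<^sub>r \<otimes> v\<close> to the function
  \<open>z \<mapsto> a\<^sub>1(z\<^sub>1) \<cdots> a\<^sub>r(z\<^sub>r) v\<close>.  It is defined on the free vector space on the tuples.\<close>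
definition tensor_eval :: "nat \<Rightarrow> (complex \<Rightarrow> 'v::ab_group_add \<Rightarrow> 'v) \<Rightarrow>
    (poly2 list \<times> 'v \<Rightarrow>\<^sub>0 complex) \<Rightarrow> point \<Rightarrow> 'v" where
  "tensor_eval r scale p z =
     lin_ext scale (\<lambda>(as, v). scale (\<Prod>i<r. ev (as ! i) (z i)) v) p"

lemma linear_tensor_eval:
  "vector_space scale \<Longrightarrow> Vector_Spaces.linear pm_scale scale (\<lambda>p. tensor_eval r scale p z)"
  unfolding tensor_eval_def using linear_lin_ext .

lemma tensor_eval_add:
  "vector_space scale \<Longrightarrow>
     tensor_eval r scale (p + q) z = tensor_eval r scale p z + tensor_eval r scale q z"
  using module_hom.add[OF Vector_Spaces.linear.axioms(3)[OF linear_tensor_eval]] by blast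

lemma tensor_eval_diff:
  "vector_space scale \<Longrightarrow>
     tensor_eval r scale (p - q) z = tensor_eval r scale p z - tensor_eval r scale q z"
  using module_hom.diff[OF Vector_Spaces.linear.axioms(3)[OF linear_tensor_eval]] by blast

lemma tensor_eval_scale:
  "vector_space scale \<Longrightarrow>
     tensor_eval r scale (pm_scale c p) z = scale c (tensor_eval r scale p z)"
  using module_hom.scale[OF Vector_Spaces.linear.axioms(3)[OF linear_tensor_eval]] by blast

lemma tensor_eval_sum:
  "vector_space scale \<Longrightarrow>
     tensor_eval r scale (\<Sum>i\<in>I. p i) z = (\<Sum>i\<in>I. tensor_eval r scale (p i) z)"
  using module_hom.sum[OF Vector_Spaces.linear.axioms(3)[OF linear_tensor_eval]] by blast

lemma tensor_eval_gen:
  assumes "vector_space scale"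
  shows "tensor_eval r scale (gen as v) z = scale (\<Prod>i<r. ev (as ! i) (z i)) v"
proof -
  interpret vector_space scale by fact
  show ?thesis by (simp add: tensor_eval_def lin_ext_single[OF assms])
qed

lemma prod_ev_update:
  assumes "length as = r" "i < r"
  shows "(\<Prod>j<r. ev (as[i := a] ! j) (z j)) = ev a (z i) * (\<Prod>j\<in>{..<r} - {i}. ev (as ! j) (z j))"
proof -
  have "(\<Prod>j<r. ev (as[i := a] ! j) (z j)) =
      ev (as[i := a] ! i) (z i) * (\<Prod>j\<in>{..<r} - {i}. ev (as[i := a] ! j) (z j))"
    using assms by (intro prod.remove) auto
  also have "(\<Prod>j\<in>{..<r} - {i}. ev (as[i := a] ! j) (z j)) = (\<Prod>j\<in>{..<r} - {i}. ev (as ! j) (z j))"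
    by (intro prod.cong) auto
  finally show ?thesis using assms by simp
qed

lemma tensor_relators_intros:
  "length as = r \<Longrightarrow> i < r \<Longrightarrow>
     gen (as[i := a + b]) v - gen (as[i := a]) v - gen (as[i := b]) v \<in> tensor_relators r scaleA scaleV"
  "length as = r \<Longrightarrow> i < r \<Longrightarrow>
     gen (as[i := scaleA c a]) v - pm_scale c (gen (as[i := a]) v) \<in> tensor_relators r scaleA scaleV"
  "length as = r \<Longrightarrow> gen as (v + w) - gen as v - gen as w \<in> tensor_relators r scaleA scaleV"
  "length as = r \<Longrightarrow> gen as (scaleV c v) - pm_scale c (gen as v) \<in> tensor_relators r scaleA scaleV"
  unfolding tensor_relators_def
  subgoal by (rule UnI1, rule UnI1, rule UnI1) (intro CollectI exI conjI; (rule refl | assumption))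
  subgoal by (rule UnI1, rule UnI1, rule UnI2) (intro CollectI exI conjI; (rule refl | assumption))
  subgoal by (rule UnI1, rule UnI2) (intro CollectI exI conjI; (rule refl | assumption))
  subgoal by (rule UnI2) (intro CollectI exI conjI; (rule refl | assumption))
  done

lemma tensor_eval_relators:
  assumes "vector_space scale" "p \<in> tensor_relators r poly2_scale scale"
  shows "tensor_eval r scale p z = 0"
proof -
  interpret vector_space scale by fact
  note simps = tensor_eval_diff[OF assms(1)] tensor_eval_scale[OF assms(1)]
    tensor_eval_gen[OF assms(1)] prod_ev_update
  from assms(2) show ?thesis
    unfolding tensor_relators_def
    by (elim UnE CollectE exE conjE; hypsubst)
      (simp_all add: simps scale_left_distrib scale_right_distrib mult.assoc mult.commute[of _ c for c]
        distrib_left distrib_right scale_left_commute)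
qed

lemma tensor_eval_span_relators:
  assumes "vector_space scale" "p \<in> pm.span (tensor_relators r poly2_scale scale)"
  shows "tensor_eval r scale p z = 0"
proof -
  interpret vector_space scale by fact
  interpret l: Vector_Spaces.linear pm_scale scale "\<lambda>p. tensor_eval r scale p z"
    by (rule linear_tensor_eval) fact
  show ?thesis
    by (rule l.eq_0_on_span[OF _ assms(2)]) (rule tensor_eval_relators[OF assms(1)])
qed

text \<open>Multilinearity reduces every generator to generators with monomials as entries.\<close>
lemma gen_mem_span_mono2:
  assumes "length as = r"
  shows "gen as v \<in> pm.span (tensor_relators r poly2_scale scale \<union>
           {gen (map mono2 e) w | e w. length e = r})" (is "_ \<in> pm.span ?B")
proof -
  have rel: "x \<in> pm.span ?B" if "x \<in> tensor_relators r poly2_scale scale" for x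
    using that by (intro pm.span_base) auto
  \<comment> \<open>induction on the number \<open>k\<close> of leading entries that need not be monomials\<close>
  have "gen as v \<in> pm.span ?B"
    if "length as = r" "k \<le> r" "\<And>i. k \<le> i \<Longrightarrow> i < r \<Longrightarrow> as ! i \<in> range mono2" for k as
    using that
  proof (induction k arbitrary: as)
    case 0
    then have "set as \<subseteq> range mono2" by (auto simp: in_set_conv_nth)
    then have "as \<in> lists (range mono2)" by auto
    then obtain e where "as = map mono2 e" unfolding lists_image by auto
    with 0 show ?case by (intro pm.span_base) auto
  next
    case (Suc k)
    have "gen (as[k := f]) v \<in> pm.span ?B" for f
    proof (induction f rule: poly2_mono2_induct)
      case (1 e)
      show ?case using Suc.prems
        by (intro Suc.IH) (auto simp: nth_list_update)
    next
      case (2 f g)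
      have "gen (as[k := f + g]) v - gen (as[k := f]) v - gen (as[k := g]) v \<in> pm.span ?B"
        using Suc.prems by (intro rel tensor_relators_intros) auto
      from pm.span_add[OF pm.span_add[OF this 2(2)] 2(1)] show ?case by simp
    next
      case (3 c f)
      have "gen (as[k := poly2_scale c f]) v - pm_scale c (gen (as[k := f]) v) \<in> pm.span ?B"
        using Suc.prems by (intro rel tensor_relators_intros) auto
      from pm.span_add[OF this pm.span_scale[OF 3, of c]] show ?case by simp
    qed
    from this[of "as ! k"] show ?case by simp
  qed
  from this[of as r] assms show ?thesis by simp
qed

lemma tensor_monomial_form:
  assumes "p \<in> pm.span (tensor_relators r poly2_scale scale \<union>
             {gen (map mono2 e) w | e w. length e = r})" (is "p \<in> pm.span (?R \<union> ?G)")
  obtains S w where "finite S" "\<And>e. e \<in> S \<Longrightarrow> length e = r"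
    "p - (\<Sum>e\<in>S. gen (map mono2 e) (w e)) \<in> pm.span (tensor_relators r poly2_scale scale)"
proof -
  have "\<exists>S w. finite S \<and> (\<forall>e\<in>S. length e = r) \<and>
      p - (\<Sum>e\<in>S. gen (map mono2 e) (w e)) \<in> pm.span ?R"
    using assms
  proof (induction rule: pm.span_induct_alt)
    case base
    then show ?case by (intro exI[of _ "{}"]) (auto intro: pm.span_zero)
  next
    case (step c x y)
    then obtain S w where S: "finite S" "\<forall>e\<in>S. length e = r"
      "y - (\<Sum>e\<in>S. gen (map mono2 e) (w e)) \<in> pm.span ?R" by blast
    from step.hyps show ?case
    proof
      assume "x \<in> ?R"
      from pm.span_add[OF pm.span_scale[OF pm.span_base[OF this], of c] S(3)] S show ?thesis
        by (intro exI[of _ S] exI[of _ w]) (auto simp: algebra_simps)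
    next
      assume "x \<in> ?G"
      then obtain e0 w0 where e0: "length e0 = r" and x: "x = gen (map mono2 e0) w0" by blast
      define w' where "w' = (\<lambda>e. if e = e0 then (if e0 \<in> S then w e0 + scale c w0 else scale c w0) else w e)"
      have sc: "gen (map mono2 e0) (scale c w0) - pm_scale c x \<in> pm.span ?R"
        unfolding x using e0 by (intro pm.span_base tensor_relators_intros) auto
      have ad: "gen (map mono2 e0) (w e0 + scale c w0) - gen (map mono2 e0) (w e0)
          - gen (map mono2 e0) (scale c w0) \<in> pm.span ?R"
        using e0 by (intro pm.span_base tensor_relators_intros) auto
      have eq: "(\<Sum>e\<in>S - {e0}. gen (map mono2 e) (w' e)) = (\<Sum>e\<in>S - {e0}. gen (map mono2 e) (w e))"
        by (intro sum.cong) (auto simp: w'_def)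
      have *: "(\<Sum>e\<in>insert e0 S. gen (map mono2 e) (w' e)) - (\<Sum>e\<in>S. gen (map mono2 e) (w e))
          - pm_scale c x \<in> pm.span ?R"
      proof (cases "e0 \<in> S")
        case True
        have 1: "(\<Sum>e\<in>insert e0 S. gen (map mono2 e) (w' e)) = gen (map mono2 e0) (w e0 + scale c w0)
            + (\<Sum>e\<in>S - {e0}. gen (map mono2 e) (w e))"
          using True eq by (simp add: insert_absorb sum.remove[OF S(1) True] w'_def)
        have 2: "(\<Sum>e\<in>S. gen (map mono2 e) (w e)) = gen (map mono2 e0) (w e0)
            + (\<Sum>e\<in>S - {e0}. gen (map mono2 e) (w e))"
          using S(1) True by (simp add: sum.remove)
        show ?thesis unfolding 1 2 using pm.span_add[OF ad sc] by (simp add: algebra_simps)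
      next
        case False
        with eq S(1) sc show ?thesis by (simp add: w'_def)
      qed
      from pm.span_diff[OF S(3) *]
      have "pm_scale c x + y - (\<Sum>e\<in>insert e0 S. gen (map mono2 e) (w' e)) \<in> pm.span ?R"
        by (simp add: algebra_simps)
      with S e0 show ?thesis by (intro exI[of _ "insert e0 S"] exI[of _ w']) auto
    qed
  qed
  then show ?thesis using that by blast
qed

text \<open>The converse of \<open>tensor_eval_span_relators\<close>: the kernel of evaluation is spanned by the relators.  Modulo
  the relators, an element is a sum of distinct monomials with one vector each, and the independence
  of the monomials forces these vectors to vanish.\<close>
lemma tensor_eval_eq_0_imp_span:
  fixes scale :: "complex \<Rightarrow> 'v::ab_group_add \<Rightarrow> 'v"
  assumes vs: "vector_space scale" and p: "p \<in> tensor_free r"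
    and zero: "\<And>z. tensor_eval r scale p z = 0"
  shows "p \<in> pm.span (tensor_relators r poly2_scale scale)" (is "_ \<in> pm.span ?R")
proof -
  interpret vector_space scale by fact
  let ?G = "{gen (map mono2 e) w :: (poly2 list \<times> 'v) \<Rightarrow>\<^sub>0 complex | e w. length e = r}"
  have "p = (\<Sum>k\<in>Poly_Mapping.keys p. pm_scale (Poly_Mapping.lookup p k) (Poly_Mapping.single k 1))"
    by (rule poly_mapping_eqI)
      (simp add: lookup_sum lookup_single when_def in_keys_iff if_distrib[of "(*) _"] sum.delta cong: if_cong)
  also have "\<dots> \<in> pm.span (?R \<union> ?G)"
  proof (intro pm.span_sum pm.span_scale)
    fix k assume "k \<in> Poly_Mapping.keys p"
    then have "length (fst k) = r" using p by (auto simp: tensor_free_def)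
    from gen_mem_span_mono2[OF this, of "snd k" scale]
    show "Poly_Mapping.single k 1 \<in> pm.span (?R \<union> ?G)" by simp
  qed
  finally obtain S w where S: "finite S" "\<And>e. e \<in> S \<Longrightarrow> length e = r"
    and span: "p - (\<Sum>e\<in>S. gen (map mono2 e) (w e)) \<in> pm.span ?R"
    by (rule tensor_monomial_form) (rule that)
  define \<chi> where "\<chi> = (\<lambda>e (z :: point). \<Prod>i<r. ev (map mono2 e ! i) (z i))"
  have \<chi>: "\<chi> e z = (\<Prod>i<r. fst (z i) ^ fst (e ! i) * snd (z i) ^ snd (e ! i))" if "length e = r" for e z
    unfolding \<chi>_def using that by (intro prod.cong) (auto simp: ev_mono2)
  have w0: "w e = 0" if "e \<in> S" for e
  proof (rule characters_independent[OF vs S(1), where \<chi> = "\<lambda>e z. \<Prod>i<r. fst (z i) ^ fst (e ! i) * snd (z i) ^ snd (e ! i)"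
        and m = "\<lambda>y z i. (fst (y i) * fst (z i), snd (y i) * snd (z i))"])
    fix e and y z :: point
    show "(\<Prod>i<r. fst (fst (y i) * fst (z i), snd (y i) * snd (z i)) ^ fst (e ! i) *
              snd (fst (y i) * fst (z i), snd (y i) * snd (z i)) ^ snd (e ! i)) =
      (\<Prod>i<r. fst (y i) ^ fst (e ! i) * snd (y i) ^ snd (e ! i)) *
      (\<Prod>i<r. fst (z i) ^ fst (e ! i) * snd (z i) ^ snd (e ! i))"
      by (simp add: power_mult_distrib algebra_simps flip: prod.distrib)
  next
    fix e
    show "\<exists>z :: point. (\<Prod>i<r. fst (z i) ^ fst (e ! i) * snd (z i) ^ snd (e ! i)) \<noteq> 0"
      by (rule exI[of _ "\<lambda>_. (1, 1)"]) simp
  next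
    fix e e' assume e: "e \<in> S" "e' \<in> S" "e \<noteq> e'"
    with S(2) obtain i where i: "i < r" "e ! i \<noteq> e' ! i" by (metis nth_equalityI)
    \<comment> \<open>the two monomials are told apart at a point with one coordinate \<open>2\<close> and all others \<open>1\<close>\<close>
    have *: "(\<Prod>j<r. fst ((if j = i then x else (1, 1)) :: complex \<times> complex) ^ fst (e ! j) *
        snd (if j = i then x else (1, 1)) ^ snd (e ! j)) = fst x ^ fst (e ! i) * snd x ^ snd (e ! i)" for x e
    proof -
      have "(\<Prod>j<r. fst ((if j = i then x else (1, 1)) :: complex \<times> complex) ^ fst (e ! j) *
          snd (if j = i then x else (1, 1)) ^ snd (e ! j)) =
        (\<Prod>j<r. if j = i then fst x ^ fst (e ! i) * snd x ^ snd (e ! i) else 1)"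
        by (intro prod.cong) auto
      then show ?thesis using i by (simp add: prod.delta)
    qed
    have inj: "(2::complex) ^ a = 2 ^ b \<longleftrightarrow> a = b" for a b :: nat
    proof -
      have "(2::complex) ^ a = 2 ^ b \<longleftrightarrow> of_nat (2 ^ a) = (of_nat (2 ^ b) :: complex)" by simp
      then show ?thesis unfolding of_nat_eq_iff by simp
    qed
    from i consider "fst (e ! i) \<noteq> fst (e' ! i)" | "snd (e ! i) \<noteq> snd (e' ! i)"
      by (auto simp: prod_eq_iff)
    then show "\<exists>z :: point. (\<Prod>i<r. fst (z i) ^ fst (e ! i) * snd (z i) ^ snd (e ! i)) \<noteq>
        (\<Prod>i<r. fst (z i) ^ fst (e' ! i) * snd (z i) ^ snd (e' ! i))"
    proof cases
      case 1
      then show ?thesis by (intro exI[of _ "\<lambda>j. if j = i then (2, 1) else (1, 1)"]) (simp only: *, simp add: inj)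
    next
      case 2
      then show ?thesis by (intro exI[of _ "\<lambda>j. if j = i then (1, 2) else (1, 1)"]) (simp only: *, simp add: inj)
    qed
  next
    fix z :: point
    have "0 = tensor_eval r scale (p - (\<Sum>e\<in>S. gen (map mono2 e) (w e))) z"
      by (rule tensor_eval_span_relators[OF vs span, symmetric])
    also have "\<dots> = - (\<Sum>e\<in>S. scale (\<chi> e z) (w e))"
      by (simp add: tensor_eval_diff[OF vs] tensor_eval_sum[OF vs] tensor_eval_gen[OF vs] zero \<chi>_def)
    also have "(\<Sum>e\<in>S. scale (\<chi> e z) (w e)) = (\<Sum>e\<in>S. scale (\<Prod>i<r. fst (z i) ^ fst (e ! i) * snd (z i) ^ snd (e ! i)) (w e))"
      using S(2) by (intro sum.cong) (auto simp: \<chi>)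
    finally show "(\<Sum>e\<in>S. scale (\<Prod>i<r. fst (z i) ^ fst (e ! i) * snd (z i) ^ snd (e ! i)) (w e)) = 0"
      by simp
  qed (fact that)
  have "gen (map mono2 e) 0 \<in> pm.span ?R" if "length e = r" for e
  proof -
    have "gen (map mono2 e) (0 + 0) - gen (map mono2 e) 0 - gen (map mono2 e) 0 \<in> pm.span ?R"
      using that by (intro pm.span_base tensor_relators_intros) auto
    from pm.span_neg[OF this] show ?thesis by simp
  qed
  then have "(\<Sum>e\<in>S. gen (map mono2 e) (w e)) \<in> pm.span ?R"
    using w0 S(2) by (intro pm.span_sum) auto
  from pm.span_add[OF span this] show ?thesis by simp
qed

lemma tensor_eq_iff_eval:
  fixes scale :: "complex \<Rightarrow> 'v::ab_group_add \<Rightarrow> 'v"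
  assumes "vector_space scale"
  shows "(p, q) \<in> tensor_eq r poly2_scale scale \<longleftrightarrow> p \<in> tensor_free r \<and> q \<in> tensor_free r \<and>
    tensor_eval r scale p = tensor_eval r scale q"
proof -
  have *: "p - q \<in> tensor_free r" if "p \<in> tensor_free r" "q \<in> tensor_free r"
    using that subsetD[OF keys_diff[of p q]] unfolding tensor_free_def by fast
  have **: "(\<forall>z. tensor_eval r scale (p - q) z = 0) \<longleftrightarrow> tensor_eval r scale p = tensor_eval r scale q"
    unfolding tensor_eval_diff[OF assms] fun_eq_iff by simp
  have "p - q \<in> pm.span (tensor_relators r poly2_scale scale) \<longleftrightarrow>
      (\<forall>z. tensor_eval r scale (p - q) z = 0)"
    if "p \<in> tensor_free r" "q \<in> tensor_free r"
    using tensor_eval_span_relators[OF assms] tensor_eval_eq_0_imp_span[OF assms *[OF that]] by blast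
  then show ?thesis
    unfolding tensor_eq_def ** by blast
qed

section \<open>Polynomial functions with values in a vector space\<close>

text \<open>The polynomial functions of the points with values in a vector space, in the coordinates
  \<open>i < r\<close>.  The scalar multiples of a polynomial function are not listed as a closure condition, since
  they follow from that of the constants.\<close>
inductive_set polyfuns :: "nat \<Rightarrow> (complex \<Rightarrow> 'v::ab_group_add \<Rightarrow> 'v) \<Rightarrow> (point \<Rightarrow> 'v) set"
  for r scale where
  const: "(\<lambda>z. w) \<in> polyfuns r scale"
| add: "F \<in> polyfuns r scale \<Longrightarrow> G \<in> polyfuns r scale \<Longrightarrow> (\<lambda>z. F z + G z) \<in> polyfuns r scale"
| mult_fst: "F \<in> polyfuns r scale \<Longrightarrow> i < r \<Longrightarrow> (\<lambda>z. scale (fst (z i)) (F z)) \<in> polyfuns r scale"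
| mult_snd: "F \<in> polyfuns r scale \<Longrightarrow> i < r \<Longrightarrow> (\<lambda>z. scale (snd (z i)) (F z)) \<in> polyfuns r scale"

lemma polyfuns_sum:
  "(\<And>k. k \<in> K \<Longrightarrow> F k \<in> polyfuns r scale) \<Longrightarrow> (\<lambda>z. \<Sum>k\<in>K. F k z) \<in> polyfuns r scale"
  by (induction K rule: infinite_finite_induct) (auto intro: polyfuns.const polyfuns.add)

lemma polyfuns_compose_linear:
  assumes "Vector_Spaces.linear scale scale' h" "F \<in> polyfuns r scale"
  shows "(\<lambda>z. h (F z)) \<in> polyfuns r scale'"
proof -
  interpret l: Vector_Spaces.linear scale scale' h by fact
  show ?thesis using assms(2)
    by induction (auto simp: l.add l.scale intro: polyfuns.intros)
qed

lemma polyfuns_scale: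
  assumes "vector_space scale" "F \<in> polyfuns r scale"
  shows "(\<lambda>z. scale c (F z)) \<in> polyfuns r scale"
proof -
  interpret vector_space scale by fact
  show ?thesis by (rule polyfuns_compose_linear[OF linear_scale_self assms(2)])
qed

lemma polyfuns_mult_ev:
  assumes "vector_space scale" "F \<in> polyfuns r scale" "i < r"
  shows "(\<lambda>z. scale (ev f (z i)) (F z)) \<in> polyfuns r scale"
proof -
  interpret vector_space scale by fact
  have p: "(\<lambda>z. scale (poly p (fst (z i))) (F z)) \<in> polyfuns r scale" for p
  proof (induction p)
    case (pCons a p)
    from polyfuns.add[OF polyfuns_scale[OF assms(1,2), of a] polyfuns.mult_fst[OF pCons(2) assms(3)]]
    show ?case by (simp add: scale_left_distrib)
  qed (simp add: polyfuns.const)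
  show ?thesis
  proof (induction f)
    case (pCons q f)
    from polyfuns.add[OF p[of q] polyfuns.mult_snd[OF pCons(2) assms(3)]]
    show ?case by (simp add: scale_left_distrib ev_pCons)
  qed (simp add: polyfuns.const)
qed

lemma polyfuns_cong_coords:
  assumes "F \<in> polyfuns r scale" "\<And>i. i < r \<Longrightarrow> y i = z i"
  shows "F y = F z"
  using assms by induction auto

lemma tensor_eval_mem_polyfuns:
  assumes "vector_space scale"
  shows "tensor_eval r scale p \<in> polyfuns r scale"
proof -
  interpret vector_space scale by fact
  have "(\<lambda>z. scale (\<Prod>i<k. ev (as ! i) (z i)) v) \<in> polyfuns r scale" if "k \<le> r" for k as v
    using that
  proof (induction k)
    case (Suc k)
    then have "(\<lambda>z. scale (\<Prod>i<k. ev (as ! i) (z i)) v) \<in> polyfuns r scale" "k < r" by simp_all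
    from polyfuns_mult_ev[OF assms this] show ?case by (simp add: mult.commute)
  qed (simp add: polyfuns.const)
  then show ?thesis
    unfolding tensor_eval_def[abs_def] lin_ext_def case_prod_unfold
    by (intro polyfuns_sum polyfuns_scale[OF assms]) blast
qed

lemma tensor_free_add: "p \<in> tensor_free r \<Longrightarrow> q \<in> tensor_free r \<Longrightarrow> p + q \<in> tensor_free r"
  using subsetD[OF keys_add[of p q]] unfolding tensor_free_def by fast

lemma keys_pm_scale: "Poly_Mapping.keys (pm_scale c p) \<subseteq> Poly_Mapping.keys p"
  by (auto simp: in_keys_iff)

lemma tensor_free_scale: "p \<in> tensor_free r \<Longrightarrow> pm_scale c p \<in> tensor_free r"
  using subsetD[OF keys_pm_scale[of c p]] unfolding tensor_free_def by fast

lemma tensor_free_0: "0 \<in> tensor_free r"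
  by (simp add: tensor_free_def)

lemma tensor_free_sum: "(\<And>i. i \<in> I \<Longrightarrow> p i \<in> tensor_free r) \<Longrightarrow> (\<Sum>i\<in>I. p i) \<in> tensor_free r"
  by (induction I rule: infinite_finite_induct) (auto intro: tensor_free_0 tensor_free_add)

lemma tensor_free_gen: "length as = r \<Longrightarrow> gen as v \<in> tensor_free r"
  by (simp add: tensor_free_def)

lemma tensor_eval_mult_ex:
  assumes "vector_space scale" "p \<in> tensor_free r" "i < r"
  shows "\<exists>q\<in>tensor_free r. tensor_eval r scale q = (\<lambda>z. scale (ev f (z i)) (tensor_eval r scale p z))"
proof -
  interpret vector_space scale by fact
  let ?q = "\<Sum>k\<in>Poly_Mapping.keys p. pm_scale (Poly_Mapping.lookup p k)
     (gen ((fst k)[i := f * fst k ! i]) (snd k))"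
  have len: "length (fst k) = r" if "k \<in> Poly_Mapping.keys p" for k
    using that assms(2) by (auto simp: tensor_free_def)
  have "tensor_eval r scale ?q z = scale (ev f (z i)) (tensor_eval r scale p z)" for z
  proof -
    have *: "(\<Prod>j<r. ev ((fst k)[i := f * fst k ! i] ! j) (z j)) =
        ev f (z i) * (\<Prod>j<r. ev (fst k ! j) (z j))" if "k \<in> Poly_Mapping.keys p" for k
      using assms(3) prod.remove[of "{..<r}" i "\<lambda>j. ev (fst k ! j) (z j)"]
      by (simp add: prod_ev_update[OF len[OF that] assms(3)] mult.assoc)
    have p: "tensor_eval r scale p z = (\<Sum>k\<in>Poly_Mapping.keys p. scale (Poly_Mapping.lookup p k)
        (scale (\<Prod>j<r. ev (fst k ! j) (z j)) (snd k)))"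
      by (simp add: tensor_eval_def lin_ext_def case_prod_unfold)
    show ?thesis
      unfolding p tensor_eval_sum[OF assms(1)] tensor_eval_scale[OF assms(1)]
        tensor_eval_gen[OF assms(1)] scale_sum_right
      by (intro sum.cong refl) (simp only: *, simp add: mult.left_commute)
  qed
  moreover have "?q \<in> tensor_free r"
    using len by (intro tensor_free_sum tensor_free_scale tensor_free_gen) auto
  ultimately show ?thesis by blast
qed

text \<open>Together with \<open>tensor_eq_iff_eval\<close> this identifies the tensor product with the space of
  polynomial functions.\<close>
lemma tensor_eval_image:
  assumes "vector_space scale"
  shows "tensor_eval r scale ` tensor_free r = polyfuns r scale"
proof (intro equalityI subsetI)
  interpret vector_space scale by fact
  fix F assume "F \<in> polyfuns r scale"
  then show "F \<in> tensor_eval r scale ` tensor_free r"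
  proof induction
    case (const w)
    show ?case
      by (rule image_eqI[of _ _ "gen (replicate r 1) w"])
        (auto simp: tensor_eval_gen[OF assms] intro!: tensor_free_gen)
  next
    case (add F G)
    then obtain p q where "p \<in> tensor_free r" "q \<in> tensor_free r"
      "F = tensor_eval r scale p" "G = tensor_eval r scale q" by blast
    then show ?case
      by (intro image_eqI[of _ _ "p + q"]) (auto simp: tensor_eval_add[OF assms] intro!: tensor_free_add)
  next
    case (mult_fst F i)
    then obtain p where "p \<in> tensor_free r" "F = tensor_eval r scale p" by blast
    with tensor_eval_mult_ex[OF assms this(1) mult_fst(2), of var1]
    obtain q where "q \<in> tensor_free r" "tensor_eval r scale q = (\<lambda>z. scale (fst (z i)) (F z))"
      by auto
    then show ?case by (metis image_eqI)
  next
    case (mult_snd F i)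
    then obtain p where "p \<in> tensor_free r" "F = tensor_eval r scale p" by blast
    with tensor_eval_mult_ex[OF assms this(1) mult_snd(2), of var2]
    obtain q where "q \<in> tensor_free r" "tensor_eval r scale q = (\<lambda>z. scale (snd (z i)) (F z))"
      by auto
    then show ?case by (metis image_eqI)
  qed
qed (auto intro: tensor_eval_mem_polyfuns[OF assms])

section \<open>The action on polynomial functions\<close>

text \<open>A basis element of the algebra consists of its kind, one of \<open>L, H, I, J\<close>, and its integer
  degree.  The kind is separated from the degree because below the degree is replaced by an arbitrary
  complex number.\<close>
datatype kind = KL | KH | KI | KJ

fun bas :: "kind \<Rightarrow> int \<Rightarrow> gca_basis" where
  "bas KL n = Lb n" | "bas KH n = Hb n" | "bas KI n = Ib n" | "bas KJ n = Jb n"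

fun kind_of :: "gca_basis \<Rightarrow> kind" where
  "kind_of (Lb n) = KL" | "kind_of (Hb n) = KH" | "kind_of (Ib n) = KI" | "kind_of (Jb n) = KJ"

fun deg_of :: "gca_basis \<Rightarrow> int" where
  "deg_of (Lb n) = n" | "deg_of (Hb n) = n" | "deg_of (Ib n) = n" | "deg_of (Jb n) = n"

lemma kind_deg_bas [simp]: "kind_of (bas X n) = X" "deg_of (bas X n) = n"
  by (cases X; simp)+

lemma bas_kind_deg: "bas (kind_of b) (deg_of b) = b"
  by (cases b) simp_all

text \<open>The parameters of a factor: the first component is true for \<open>\<Omega>(\<lambda>, \<sigma>, \<eta>)\<close> and false
  for \<open>\<Gamma>(\<lambda>, \<sigma>, \<eta>)\<close>, the others are \<open>\<lambda>\<close>, \<open>\<sigma>\<close> and \<open>\<eta>\<close>.\<close>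
type_synonym param = "bool \<times> complex \<times> complex \<times> complex"

text \<open>The base \<open>\<lambda>\<close> of the powers by which a factor is twisted.\<close>
definition base :: "param \<Rightarrow> complex" where "base q = fst (snd q)"

text \<open>The scalar \<open>\<sigma>\<close>.\<close>
definition weight :: "param \<Rightarrow> complex" where "weight q = fst (snd (snd q))"

text \<open>The action on a factor with the given parameters.\<close>
fun pmod :: "param \<Rightarrow> gca \<Rightarrow> poly2 \<Rightarrow> poly2" where
  "pmod (om, l, s, e) = (if om then Omega l s e else Gamma l s e)"

text \<open>On both types of factors, a basis element of kind \<open>X\<close> and degree \<open>n\<close> acts as \<open>\<lambda>\<^sup>n\<close> times the
  operator that substitutes \<open>pshift X n\<close> into a polynomial and then multiplies it by the function
  \<open>pcoef q X n\<close>.  Both are polynomial in \<open>n\<close> and are defined with a complex number \<open>a\<close> in its place.\<close>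
fun pcoef :: "param \<Rightarrow> kind \<Rightarrow> complex \<Rightarrow> complex \<times> complex \<Rightarrow> complex" where
  "pcoef (om, l, s, e) KL a z = fst z - (if om then a else - a) * snd z + a * e"
| "pcoef (om, l, s, e) KH a z = snd z"
| "pcoef (om, l, s, e) KI a z = (if om then s else 0)"
| "pcoef (om, l, s, e) KJ a z = (if om then 0 else s)"

fun pshift :: "kind \<Rightarrow> complex \<Rightarrow> complex \<times> complex \<Rightarrow> complex \<times> complex" where
  "pshift KI a z = (fst z - a, snd z - 1)"
| "pshift KJ a z = (fst z - a, snd z + 1)"
| "pshift _ a z = (fst z - a, snd z)"

lemma ev_pmod:
  "ev (pmod q x f) z = (\<Sum>b\<in>Poly_Mapping.keys x. Poly_Mapping.lookup x b *
     (base q powi deg_of b * (pcoef q (kind_of b) (of_int (deg_of b)) z *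
        ev f (pshift (kind_of b) (of_int (deg_of b)) z))))"
proof -
  obtain om l s e where q: "q = (om, l, s, e)" by (cases q)
  have "ev (Omega_basis l s e f b) z = l powi deg_of b * (pcoef (True, l, s, e) (kind_of b) (of_int (deg_of b)) z *
        ev f (pshift (kind_of b) (of_int (deg_of b)) z))" for b
    by (cases b; simp only: Omega_basis.simps Gamma_basis.simps ev_simps ev_shift2 kind_of.simps
        deg_of.simps pcoef.simps pshift.simps if_True if_False) simp_all
  moreover have "ev (Gamma_basis l s e f b) z = l powi deg_of b * (pcoef (False, l, s, e) (kind_of b) (of_int (deg_of b)) z *
        ev f (pshift (kind_of b) (of_int (deg_of b)) z))" for b
    by (cases b; simp only: Omega_basis.simps Gamma_basis.simps ev_simps ev_shift2 kind_of.simps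
        deg_of.simps pcoef.simps pshift.simps if_True if_False) simp_all
  ultimately show ?thesis
    by (cases om) (simp_all add: q base_def Omega_def Gamma_def lin_ext_def ev_sum)
qed

text \<open>The operator just described, without the factor \<open>\<lambda>\<^sup>n\<close> and with \<open>a\<close> in place of \<open>n\<close>, acting in
  the \<open>i\<close>-th coordinate of a function of points.\<close>
definition facop :: "(complex \<Rightarrow> 'v::ab_group_add \<Rightarrow> 'v) \<Rightarrow> (nat \<Rightarrow> param) \<Rightarrow> kind \<Rightarrow> complex \<Rightarrow> nat \<Rightarrow>
    (point \<Rightarrow> 'v) \<Rightarrow> point \<Rightarrow> 'v" where
  "facop scale par X a i F z = scale (pcoef (par i) X a (z i)) (F (z(i := pshift X a (z i))))"

text \<open>The action of the algebra on functions of points that corresponds to the Leibniz action on tensors.\<close>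
definition fun_act :: "nat \<Rightarrow> (nat \<Rightarrow> param) \<Rightarrow> (complex \<Rightarrow> 'v::ab_group_add \<Rightarrow> 'v) \<Rightarrow> (gca \<Rightarrow> 'v \<Rightarrow> 'v) \<Rightarrow>
    gca \<Rightarrow> (point \<Rightarrow> 'v) \<Rightarrow> point \<Rightarrow> 'v" where
  "fun_act r par scale act x F z =
     lin_ext scale (\<lambda>b. \<Sum>i<r. scale (base (par i) powi deg_of b)
        (facop scale par (kind_of b) (of_int (deg_of b)) i F z)) x + act x (F z)"

text \<open>The module of polynomial functions with this action.\<close>
definition fun_struct :: "nat \<Rightarrow> (nat \<Rightarrow> param) \<Rightarrow> (complex \<Rightarrow> 'v::ab_group_add \<Rightarrow> 'v) \<Rightarrow> (gca \<Rightarrow> 'v \<Rightarrow> 'v) \<Rightarrow>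
    (point \<Rightarrow> 'v) gca_struct" where
  "fun_struct r par scale act =
     \<lparr>car = polyfuns r scale, add = (\<lambda>F G z. F z + G z), scal = (\<lambda>c F z. scale c (F z)),
      action = fun_act r par scale act\<rparr>"

lemma fun_act_linear_comb:
  assumes "gca_module scale act"
  shows "fun_act r par scale act x (\<lambda>z. \<Sum>k\<in>K. scale (c k) (F k z)) z =
    (\<Sum>k\<in>K. scale (c k) (fun_act r par scale act x (F k) z))"
proof -
  interpret gca_module scale act by fact
  interpret l: Vector_Spaces.linear scale scale "act x" by (rule linear_right)
  have "fun_act r par scale act x (\<lambda>z. \<Sum>k\<in>K. scale (c k) (F k z)) z =
    (\<Sum>b\<in>Poly_Mapping.keys x. \<Sum>i<r. \<Sum>k\<in>K. scale (c k) (scale (Poly_Mapping.lookup x b)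
       (scale (base (par i) powi deg_of b)
        (facop scale par (kind_of b) (of_int (deg_of b)) i (F k) z)))) + (\<Sum>k\<in>K. scale (c k) (act x (F k z)))"
    by (simp add: fun_act_def lin_ext_def facop_def l.sum l.scale scale_sum_right mult_ac)
  also have "(\<Sum>b\<in>Poly_Mapping.keys x. \<Sum>i<r. \<Sum>k\<in>K. scale (c k) (scale (Poly_Mapping.lookup x b)
       (scale (base (par i) powi deg_of b)
        (facop scale par (kind_of b) (of_int (deg_of b)) i (F k) z)))) =
      (\<Sum>k\<in>K. \<Sum>b\<in>Poly_Mapping.keys x. \<Sum>i<r. scale (c k) (scale (Poly_Mapping.lookup x b)
       (scale (base (par i) powi deg_of b)
        (facop scale par (kind_of b) (of_int (deg_of b)) i (F k) z))))"
    by (subst (2) sum.swap, subst sum.swap) simp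
  finally show ?thesis
    by (simp add: fun_act_def lin_ext_def scale_sum_right scale_right_distrib sum.distrib)
qed

lemma tensor_eval_act:
  assumes "gca_module scale act" "p \<in> tensor_free r"
  shows "tensor_eval r scale (tensor_free_act (map (\<lambda>i. pmod (par i)) [0..<r]) act x p) =
    fun_act r par scale act x (tensor_eval r scale p)"
proof
  fix z
  interpret gca_module scale act by fact
  have vs: "vector_space scale" by (rule vector_space_axioms)
  interpret l: Vector_Spaces.linear scale scale "act x" by (rule linear_right)
  let ?acts = "map (\<lambda>i. pmod (par i)) [0..<r]"
  have gen: "tensor_eval r scale ((\<Sum>i<length ?acts. gen (as[i := (?acts ! i) x (as ! i)]) v) + gen as (act x v)) z =
     fun_act r par scale act x (\<lambda>z. scale (\<Prod>i<r. ev (as ! i) (z i)) v) z"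
    if len: "length as = r" for as v
  proof -
    have upd: "ev f (pshift X a (z i)) * (\<Prod>j\<in>{..<r} - {i}. ev (as ! j) (z j)) =
        (\<Prod>j<r. ev (as ! j) ((z(i := pshift X a (z i))) j))" if "i < r" "f = as ! i" for f X a i
    proof -
      have eq: "(\<Prod>j\<in>{..<r} - {i}. ev (as ! j) ((z(i := pshift X a (z i))) j)) =
          (\<Prod>j\<in>{..<r} - {i}. ev (as ! j) (z j))"
        by (intro prod.cong) auto
      have "(\<Prod>j<r. g j) = g i * (\<Prod>j\<in>{..<r} - {i}. g j)" for g :: "nat \<Rightarrow> complex"
        using that by (intro prod.remove) auto
      from this[of "\<lambda>j. ev (as ! j) ((z(i := pshift X a (z i))) j)"] show ?thesis
        by (simp only: eq fun_upd_same that(2))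
    qed
    have "tensor_eval r scale ((\<Sum>i<length ?acts. gen (as[i := (?acts ! i) x (as ! i)]) v) + gen as (act x v)) z =
       (\<Sum>i<r. scale (ev (pmod (par i) x (as ! i)) (z i) * (\<Prod>j\<in>{..<r} - {i}. ev (as ! j) (z j))) v)
         + scale (\<Prod>i<r. ev (as ! i) (z i)) (act x v)"
      by (simp add: tensor_eval_add[OF vs] tensor_eval_sum[OF vs] tensor_eval_gen[OF vs]
          prod_ev_update[OF len])
    also have "(\<Sum>i<r. scale (ev (pmod (par i) x (as ! i)) (z i) * (\<Prod>j\<in>{..<r} - {i}. ev (as ! j) (z j))) v) =
       (\<Sum>i<r. \<Sum>b\<in>Poly_Mapping.keys x. scale (Poly_Mapping.lookup x b) (scale (base (par i) powi deg_of b)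
         (facop scale par (kind_of b) (of_int (deg_of b)) i (\<lambda>z. scale (\<Prod>i<r. ev (as ! i) (z i)) v) z)))"
    proof (intro sum.cong refl)
      fix i assume "i \<in> {..<r}"
      then have i: "i < r" by simp
      show "scale (ev (pmod (par i) x (as ! i)) (z i) * (\<Prod>j\<in>{..<r} - {i}. ev (as ! j) (z j))) v =
        (\<Sum>b\<in>Poly_Mapping.keys x. scale (Poly_Mapping.lookup x b) (scale (base (par i) powi deg_of b)
         (facop scale par (kind_of b) (of_int (deg_of b)) i (\<lambda>z. scale (\<Prod>i<r. ev (as ! i) (z i)) v) z)))"
        unfolding ev_pmod facop_def sum_distrib_right scale_sum_left
        by (intro sum.cong refl) (simp only: mult.assoc upd[OF i refl] scale_scale)
    qed
    also have "\<dots> = (\<Sum>b\<in>Poly_Mapping.keys x. scale (Poly_Mapping.lookup x b) (\<Sum>i<r. scale (base (par i) powi deg_of b)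
         (facop scale par (kind_of b) (of_int (deg_of b)) i (\<lambda>z. scale (\<Prod>i<r. ev (as ! i) (z i)) v) z)))"
      unfolding scale_sum_right by (rule sum.swap)
    finally show ?thesis
      by (simp add: fun_act_def lin_ext_def l.scale)
  qed
  have len: "length (fst k) = r" if "k \<in> Poly_Mapping.keys p" for k
    using that assms(2) by (auto simp: tensor_free_def)
  have "tensor_eval r scale (tensor_free_act ?acts act x p) z =
      (\<Sum>k\<in>Poly_Mapping.keys p. scale (Poly_Mapping.lookup p k)
        (fun_act r par scale act x (\<lambda>z. scale (\<Prod>i<r. ev (fst k ! i) (z i)) (snd k)) z))"
    unfolding tensor_free_act_def lin_ext_def case_prod_unfold
      tensor_eval_sum[OF vs] tensor_eval_scale[OF vs]
    by (intro sum.cong refl) (simp only: gen[OF len])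
  also have "\<dots> = fun_act r par scale act x (tensor_eval r scale p) z"
    unfolding fun_act_linear_comb[OF assms(1), symmetric]
    unfolding tensor_eval_def[abs_def] lin_ext_def case_prod_unfold by simp
  finally show "tensor_eval r scale (tensor_free_act ?acts act x p) z =
    fun_act r par scale act x (tensor_eval r scale p) z" .
qed

lemma tensor_free_act_mem:
  assumes "length acts = r" "p \<in> tensor_free r"
  shows "tensor_free_act acts act x p \<in> tensor_free r"
  using assms unfolding tensor_free_act_def lin_ext_def case_prod_unfold
  by (intro tensor_free_sum tensor_free_scale tensor_free_add tensor_free_gen)
    (auto simp: tensor_free_def)

section \<open>The tensor product as a module of polynomial functions\<close>

text \<open>The carrier is closed under all operations.\<close>
definition closed_struct :: "'v gca_struct \<Rightarrow> bool" where
  "closed_struct M \<longleftrightarrow> (\<forall>u\<in>car M. \<forall>v\<in>car M. add M u v \<in> car M) \<and>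
     (\<forall>c. \<forall>v\<in>car M. scal M c v \<in> car M) \<and> (\<forall>x. \<forall>v\<in>car M. action M x v \<in> car M)"

lemma gca_iso_sym:
  assumes "gca_iso M N" "closed_struct M"
  shows "gca_iso N M"
proof -
  from assms(1) obtain f where f: "bij_betw f (car M) (car N)"
    "\<And>u v. u \<in> car M \<Longrightarrow> v \<in> car M \<Longrightarrow> f (add M u v) = add N (f u) (f v)"
    "\<And>c v. v \<in> car M \<Longrightarrow> f (scal M c v) = scal N c (f v)"
    "\<And>x v. v \<in> car M \<Longrightarrow> f (action M x v) = action N x (f v)"
    unfolding gca_iso_def by blast
  define g where "g = inv_into (car M) f"
  have g: "bij_betw g (car N) (car M)" unfolding g_def by (rule bij_betw_inv_into[OF f(1)])
  have gM: "g y \<in> car M" if "y \<in> car N" for y using bij_betwE[OF g] that by blast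
  have fg: "f (g y) = y" if "y \<in> car N" for y
    unfolding g_def by (rule bij_betw_inv_into_right[OF f(1) that])
  have gf: "g (f y) = y" if "y \<in> car M" for y
    unfolding g_def by (rule bij_betw_inv_into_left[OF f(1) that])
  note cl = assms(2)[unfolded closed_struct_def]
  show ?thesis unfolding gca_iso_def
  proof (intro exI[of _ g] conjI ballI allI g)
    show "g (add N u v) = add M (g u) (g v)" if "u \<in> car N" "v \<in> car N" for u v
      using f(2)[of "g u" "g v"] gf[of "add M (g u) (g v)"] cl gM fg that by metis
    show "g (scal N c v) = scal M c (g v)" if "v \<in> car N" for c v
      using f(3)[of "g v" c] gf[of "scal M c (g v)"] cl gM fg that by metis
    show "g (action N x v) = action M x (g v)" if "v \<in> car N" for x v
      using f(4)[of "g v" x] gf[of "action M x (g v)"] cl gM fg that by metis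
  qed
qed

lemma gca_iso_trans:
  assumes "gca_iso M N" "gca_iso N K"
  shows "gca_iso M K"
proof -
  from assms(1) obtain f where f: "bij_betw f (car M) (car N)"
    "\<And>u v. u \<in> car M \<Longrightarrow> v \<in> car M \<Longrightarrow> f (add M u v) = add N (f u) (f v)"
    "\<And>c v. v \<in> car M \<Longrightarrow> f (scal M c v) = scal N c (f v)"
    "\<And>x v. v \<in> car M \<Longrightarrow> f (action M x v) = action N x (f v)"
    unfolding gca_iso_def by blast
  from assms(2) obtain g where g: "bij_betw g (car N) (car K)"
    "\<And>u v. u \<in> car N \<Longrightarrow> v \<in> car N \<Longrightarrow> g (add N u v) = add K (g u) (g v)"
    "\<And>c v. v \<in> car N \<Longrightarrow> g (scal N c v) = scal K c (g v)"
    "\<And>x v. v \<in> car N \<Longrightarrow> g (action N x v) = action K x (g v)"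
    unfolding gca_iso_def by blast
  have fN: "f u \<in> car N" if "u \<in> car M" for u using bij_betwE[OF f(1)] that by blast
  show ?thesis unfolding gca_iso_def
    using bij_betw_trans[OF f(1) g(1)] f(2-) g(2-) fN
    by (intro exI[of _ "g \<circ> f"]) auto
qed

text \<open>Evaluation induces an isomorphism from the tensor product to the module of polynomial functions.\<close>
lemma
  fixes scale :: "complex \<Rightarrow> 'v::ab_group_add \<Rightarrow> 'v"
  assumes mod: "gca_module scale act"
  defines "T \<equiv> \<lambda>r par. gca_tensor poly2_scale (map (\<lambda>i. pmod (par i)) [0..<r]) scale act"
  shows tensor_iso_fun_struct: "gca_iso (T r par) (fun_struct r par scale act)"
    and closed_tensor: "closed_struct (T r par)"
proof -
  interpret gca_module scale act by fact
  have vs: "vector_space scale" by (rule vector_space_axioms)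
  let ?acts = "map (\<lambda>i. pmod (par i)) [0..<r]"
  let ?ev = "tensor_eval r scale"
  \<comment> \<open>The elements of the tensor product are the fibres of evaluation.\<close>
  define cls where "cls p = {q \<in> tensor_free r. ?ev q = ?ev p}" for p
  have E: "tensor_eq r poly2_scale scale `` {p} = cls p" if "p \<in> tensor_free r" for p
    using that by (auto simp: cls_def tensor_eq_iff_eval[OF vs])
  have self: "p \<in> cls p" if "p \<in> tensor_free r" for p
    using that by (simp add: cls_def)
  have cls_eq: "cls p = cls q" if "?ev p = ?ev q" for p q
    using that by (simp add: cls_def)
  have car: "car (T r par) = cls ` tensor_free r"
    by (auto simp: T_def gca_tensor_def Let_def quotient_def E)
  have add: "add (T r par) (cls p) (cls q) = cls (p + q)"
    if "p \<in> tensor_free r" "q \<in> tensor_free r" for p q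
  proof -
    have "add (T r par) (cls p) (cls q) =
        (\<Union>p'\<in>cls p. \<Union>q'\<in>cls q. tensor_eq r poly2_scale scale `` {p' + q'})"
      by (simp add: T_def gca_tensor_def Let_def)
    also have "\<dots> = (\<Union>p'\<in>cls p. \<Union>q'\<in>cls q. cls (p + q))"
    proof (intro SUP_cong refl)
      fix p' q' assume "p' \<in> cls p" "q' \<in> cls q"
      then show "tensor_eq r poly2_scale scale `` {p' + q'} = cls (p + q)"
        by (subst E) (auto simp: cls_def tensor_free_add tensor_eval_add[OF vs, abs_def])
    qed
    also have "\<dots> = cls (p + q)" using self that by auto
    finally show ?thesis .
  qed
  have scal: "scal (T r par) c (cls p) = cls (pm_scale c p)" if "p \<in> tensor_free r" for c p
  proof -
    have "scal (T r par) c (cls p) = (\<Union>p'\<in>cls p. tensor_eq r poly2_scale scale `` {pm_scale c p'})"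
      by (simp add: T_def gca_tensor_def Let_def)
    also have "\<dots> = (\<Union>p'\<in>cls p. cls (pm_scale c p))"
    proof (intro SUP_cong refl)
      fix p' assume "p' \<in> cls p"
      then show "tensor_eq r poly2_scale scale `` {pm_scale c p'} = cls (pm_scale c p)"
        by (subst E) (auto simp: cls_def tensor_free_scale tensor_eval_scale[OF vs, abs_def])
    qed
    also have "\<dots> = cls (pm_scale c p)" using self that by auto
    finally show ?thesis .
  qed
  note act_mem = tensor_free_act_mem[of ?acts r, simplified]
  have act: "action (T r par) x (cls p) = cls (tensor_free_act ?acts act x p)"
    if "p \<in> tensor_free r" for x p
  proof -
    have "action (T r par) x (cls p) = (\<Union>p'\<in>cls p. tensor_eq r poly2_scale scale `` {tensor_free_act ?acts act x p'})"
      by (simp add: T_def gca_tensor_def Let_def)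
    also have "\<dots> = (\<Union>p'\<in>cls p. cls (tensor_free_act ?acts act x p))"
    proof (intro SUP_cong refl)
      fix p' assume "p' \<in> cls p"
      then have "p' \<in> tensor_free r" "?ev p' = ?ev p" by (auto simp: cls_def)
      then show "tensor_eq r poly2_scale scale `` {tensor_free_act ?acts act x p'} =
          cls (tensor_free_act ?acts act x p)"
        using that by (subst E) (auto intro!: cls_eq act_mem simp: tensor_eval_act[OF mod])
    qed
    also have "\<dots> = cls (tensor_free_act ?acts act x p)" using self that by auto
    finally show ?thesis .
  qed
  show "closed_struct (T r par)"
    unfolding closed_struct_def car
    by (auto simp: add scal act intro!: imageI tensor_free_add tensor_free_scale act_mem)
  define f where "f X = ?ev (SOME p. p \<in> X)" for X
  have f: "f (cls p) = ?ev p" if "p \<in> tensor_free r" for p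
  proof -
    have "(SOME q. q \<in> cls p) \<in> cls p" using self[OF that] by (rule someI)
    then show ?thesis by (simp add: f_def cls_def)
  qed
  have "bij_betw f (car (T r par)) (polyfuns r scale)"
    unfolding bij_betw_def car tensor_eval_image[OF vs, symmetric]
    by (auto simp: inj_on_def f image_image) (auto simp: cls_def)
  then show "gca_iso (T r par) (fun_struct r par scale act)"
    unfolding gca_iso_def
    by (intro exI[of _ f])
      (auto simp: car fun_struct_def add scal act f tensor_free_add tensor_free_scale act_mem
        tensor_eval_act[OF mod] tensor_eval_add[OF vs] tensor_eval_scale[OF vs])
qed

text \<open>Factors are numbered from \<open>0\<close> here, while the parameter sequences start at index \<open>1\<close>.\<close>
lemma T_module_eq:
  "T_module (m1, m2) lam sig eta scale act = gca_tensor poly2_scale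
     (map (\<lambda>i. pmod (i < m1, lam (Suc i), sig (Suc i), eta (Suc i))) [0..<m1 + m2]) scale act"
proof -
  have "map (\<lambda>k. Omega (lam k) (sig k) (eta k)) [1..<fst (m1, m2) + 1] @
      map (\<lambda>k. Gamma (lam k) (sig k) (eta k)) [fst (m1, m2) + 1..<fst (m1, m2) + snd (m1, m2) + 1] =
    map (\<lambda>i. pmod (i < m1, lam (Suc i), sig (Suc i), eta (Suc i))) [0..<m1 + m2]"
    by (rule nth_equalityI) (auto simp: nth_append simp del: upt_Suc)
  then show ?thesis unfolding T_module_def by simp
qed

section \<open>Independence of exponential polynomials\<close>

lemma degree_shift_diff:
  fixes p :: "complex poly"
  assumes "p \<noteq> 0"
  defines "d \<equiv> pcompose p [:1, 1:] - p"
  shows "d = 0 \<or> degree d < degree p"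
proof -
  have deg: "degree (pcompose p [:1, 1:]) = degree p"
    by (simp add: degree_pcompose)
  have "lead_coeff (pcompose p [:1, 1:]) = lead_coeff p"
    by (subst lead_coeff_comp) simp_all
  then have *: "coeff d (degree p) = 0" by (simp add: d_def deg)
  have "degree d \<le> degree p"
    unfolding d_def using deg by (metis degree_diff_le order_refl)
  with * show ?thesis by (metis le_neq_implies_less leading_coeff_0_iff)
qed

text \<open>If \<open>\<Sum>\<^sub>\<kappa> \<kappa>\<^sup>n p\<^sub>\<kappa>(n)\<close> vanishes for all large \<open>n\<close>, with distinct nonzero \<open>\<kappa>\<close>, then all
  polynomials \<open>p\<^sub>\<kappa>\<close> are zero.  The induction measure counts the coefficients up to the degree.\<close>
lemma exp_poly_independent:
  fixes p :: "complex \<Rightarrow> complex poly"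
  assumes "finite K" "0 \<notin> K"
    and "\<And>n. n \<ge> n0 \<Longrightarrow> (\<Sum>\<kappa>\<in>K. \<kappa> ^ n * poly (p \<kappa>) (of_nat n)) = 0"
    and "\<kappa> \<in> K"
  shows "p \<kappa> = 0"
proof -
  define size where "size q = (if q = 0 then 0 else Suc (degree q))" for q :: "complex poly"
  show ?thesis
    using assms(3,4)
  proof (induction "\<Sum>\<kappa>\<in>K. size (p \<kappa>)" arbitrary: p \<kappa> rule: less_induct)
    case less
    show ?case
    proof (cases "\<forall>\<kappa>\<in>K. p \<kappa> = 0")
      case False
      then obtain \<kappa>0 where k0: "\<kappa>0 \<in> K" "p \<kappa>0 \<noteq> 0" by blast
      with \<open>0 \<notin> K\<close> have "\<kappa>0 \<noteq> 0" by auto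
      \<comment> \<open>Applying \<open>E - \<kappa>0\<close>, with \<open>E\<close> the shift of \<open>n\<close>, lowers the degree of \<open>p \<kappa>0\<close> or makes it zero; it multiplies the
        leading coefficients of the other \<open>p \<kappa>\<close> by \<open>\<kappa> - \<kappa>0\<close>.\<close>
      define q where "q \<kappa> = smult \<kappa> (pcompose (p \<kappa>) [:1, 1:]) - smult \<kappa>0 (p \<kappa>)" for \<kappa>
      have "size (q \<kappa>) \<le> size (p \<kappa>)" for \<kappa>
      proof (cases "p \<kappa> = 0")
        case False
        have "degree (q \<kappa>) \<le> degree (p \<kappa>)"
          unfolding q_def by (intro degree_diff_le) (auto simp: degree_pcompose intro: order_trans[OF degree_smult_le])
        with False show ?thesis by (simp add: size_def)
      qed (simp add: q_def size_def)
      moreover have "size (q \<kappa>0) < size (p \<kappa>0)"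
      proof -
        have "q \<kappa>0 = smult \<kappa>0 (pcompose (p \<kappa>0) [:1, 1:] - p \<kappa>0)"
          by (simp add: q_def smult_diff_right)
        with degree_shift_diff[OF k0(2)] k0(2) \<open>\<kappa>0 \<noteq> 0\<close> show ?thesis by (auto simp: size_def)
      qed
      ultimately have small: "(\<Sum>\<kappa>\<in>K. size (q \<kappa>)) < (\<Sum>\<kappa>\<in>K. size (p \<kappa>))"
        using \<open>finite K\<close> k0(1) by (intro sum_strict_mono_ex1) auto
      have zero: "(\<Sum>\<kappa>\<in>K. \<kappa> ^ n * poly (q \<kappa>) (of_nat n)) = 0" if "n \<ge> n0" for n
      proof -
        have "(\<Sum>\<kappa>\<in>K. \<kappa> ^ n * poly (q \<kappa>) (of_nat n)) =
            (\<Sum>\<kappa>\<in>K. \<kappa> ^ Suc n * poly (p \<kappa>) (of_nat (Suc n)))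
            - \<kappa>0 * (\<Sum>\<kappa>\<in>K. \<kappa> ^ n * poly (p \<kappa>) (of_nat n))"
          unfolding sum_distrib_left sum_subtractf[symmetric]
          by (intro sum.cong refl) (simp add: q_def poly_pcompose algebra_simps)
        with less.prems(1)[of n] less.prems(1)[of "Suc n"] that show ?thesis by simp
      qed
      have q0: "q \<kappa> = 0" if "\<kappa> \<in> K" for \<kappa>
        using less.hyps[OF small zero that] .
      have others: "p \<kappa> = 0" if "\<kappa> \<in> K - {\<kappa>0}" for \<kappa>
      proof -
        have deg: "degree (pcompose (p \<kappa>) [:1, 1:]) = degree (p \<kappa>)"
          by (simp add: degree_pcompose)
        have "lead_coeff (pcompose (p \<kappa>) [:1, 1:]) = lead_coeff (p \<kappa>)"
          by (subst lead_coeff_comp) simp_all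
        then have "coeff (q \<kappa>) (degree (p \<kappa>)) = (\<kappa> - \<kappa>0) * lead_coeff (p \<kappa>)"
          by (simp add: q_def deg algebra_simps)
        with q0[of \<kappa>] that show ?thesis by simp
      qed
      have "poly (p \<kappa>0) (of_nat n) = 0" if "n \<ge> n0" for n
      proof -
        have "(\<Sum>\<kappa>\<in>K. \<kappa> ^ n * poly (p \<kappa>) (of_nat n)) = \<kappa>0 ^ n * poly (p \<kappa>0) (of_nat n)"
          using others by (simp add: sum.remove[OF \<open>finite K\<close> k0(1)])
        with less.prems(1)[OF that] \<open>\<kappa>0 \<noteq> 0\<close> show ?thesis by simp
      qed
      then have "of_nat ` {n0..} \<subseteq> {x. poly (p \<kappa>0) x = 0}" by auto
      moreover have "infinite (of_nat ` {n0..} :: complex set)"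
        by (simp add: finite_image_iff inj_on_def infinite_Ici)
      ultimately have "infinite {x. poly (p \<kappa>0) x = 0}" using finite_subset by blast
      with poly_roots_finite[OF k0(2)] show ?thesis by blast
    qed (use less.prems in blast)
  qed
qed

lemma ex_separating_functional:
  fixes scale :: "complex \<Rightarrow> 'v::ab_group_add \<Rightarrow> 'v"
  assumes "vector_space scale" "v \<noteq> 0"
  obtains l where "Vector_Spaces.linear scale (*) l" "l v \<noteq> (0::complex)"
proof -
  interpret vector_space scale by fact
  define B where "B = extend_basis {}"
  have B: "independent B" "span B = UNIV"
    using independent_extend_basis[OF independent_empty] span_extend_basis[OF independent_empty]
    by (auto simp: B_def)
  have lin: "Vector_Spaces.linear scale (*) (\<lambda>v. representation B v b)" for b
  proof (intro Vector_Spaces.linear.intro vector_space_axioms module_hom.intro module_axioms module_hom_axioms.intro)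
    show "vector_space ((*) :: complex \<Rightarrow> complex \<Rightarrow> complex)"
      by unfold_locales (auto simp: algebra_simps)
    then show "module ((*) :: complex \<Rightarrow> complex \<Rightarrow> complex)" 
      by (simp add: module_iff_vector_space)
  qed (simp_all add: representation_add representation_scale B)
  have "\<exists>b. representation B v b \<noteq> 0"
  proof (rule ccontr)
    assume "\<not> ?thesis"
    with sum_nonzero_representation_eq[OF B(1), of v] B(2) assms(2) show False by simp
  qed
  with lin that show ?thesis by blast
qed

text \<open>A function of one complex variable that is a polynomial with vector coefficients.\<close>
definition vpoly :: "(complex \<Rightarrow> 'v::ab_group_add \<Rightarrow> 'v) \<Rightarrow> (complex \<Rightarrow> 'v) \<Rightarrow> bool" where
  "vpoly scale u \<longleftrightarrow> (\<exists>d c. \<forall>a. u a = (\<Sum>j<d. scale (a ^ j) (c (j::nat))))"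

lemma vpoly_functional:
  assumes "vpoly scale u" "Vector_Spaces.linear scale (*) l"
  obtains p where "\<And>a. l (u a) = poly p a"
proof -
  interpret l: Vector_Spaces.linear scale "(*)" l by fact
  from assms(1) obtain d c where "\<And>a. u a = (\<Sum>j<d. scale (a ^ j) (c j))"
    unfolding vpoly_def by blast
  then have "l (u a) = poly (\<Sum>j<d. monom (l (c j)) j) a" for a
    by (simp add: l.sum l.scale poly_sum poly_monom mult.commute)
  then show ?thesis by (rule that)
qed

text \<open>The vector-valued version, for summands indexed by a finite set on which the base \<open>b\<close> need not be
  injective: the summands that belong to one base add up to zero.  The conclusion holds at every complex
  number \<open>x\<close>, although the hypothesis is about large integers only.\<close>
lemma exp_vpoly_independent:
  fixes scale :: "complex \<Rightarrow> 'v::ab_group_add \<Rightarrow> 'v" and u :: "'i \<Rightarrow> complex \<Rightarrow> 'v"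
  assumes vs: "vector_space scale" and "finite A" "\<And>i. i \<in> A \<Longrightarrow> b i \<noteq> 0"
    and poly: "\<And>i. i \<in> A \<Longrightarrow> vpoly scale (u i)"
    and zero: "\<And>n. n \<ge> n0 \<Longrightarrow> (\<Sum>i\<in>A. scale (b i ^ n) (u i (of_nat n))) = 0"
  shows "(\<Sum>i | i \<in> A \<and> b i = \<kappa>. u i x) = 0"
proof (rule ccontr)
  assume "(\<Sum>i | i \<in> A \<and> b i = \<kappa>. u i x) \<noteq> 0"
  then obtain l where l: "Vector_Spaces.linear scale (*) l" "l (\<Sum>i | i \<in> A \<and> b i = \<kappa>. u i x) \<noteq> (0::complex)"
    by (rule ex_separating_functional[OF vs])
  interpret l: Vector_Spaces.linear scale "(*)" l by fact
  have "\<exists>p. \<forall>i\<in>A. \<forall>a. l (u i a) = poly (p i) a"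
    by (intro bchoice ballI) (metis vpoly_functional[OF poly l(1)])
  then obtain p where p: "\<And>i a. i \<in> A \<Longrightarrow> l (u i a) = poly (p i) a" by blast
  have "\<kappa> \<in> b ` A"
  proof (rule ccontr)
    assume "\<kappa> \<notin> b ` A"
    then have "{i. i \<in> A \<and> b i = \<kappa>} = {}" by auto
    then show False using l(2) unfolding \<open>_ = {}\<close> sum.empty l.zero by simp
  qed
  have "(\<Sum>i | i \<in> A \<and> b i = \<kappa>. p i) = 0"
  proof (rule exp_poly_independent[of "b ` A" n0 "\<lambda>\<kappa>. \<Sum>i | i \<in> A \<and> b i = \<kappa>. p i"])
    fix n assume n: "n \<ge> n0"
    have "0 = l (\<Sum>i\<in>A. scale (b i ^ n) (u i (of_nat n)))"
      by (simp add: zero[OF n] l.zero)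
    also have "\<dots> = (\<Sum>i\<in>A. b i ^ n * poly (p i) (of_nat n))"
      by (simp add: l.sum l.scale p)
    also have "\<dots> = (\<Sum>\<kappa>\<in>b ` A. \<Sum>i | i \<in> A \<and> b i = \<kappa>. b i ^ n * poly (p i) (of_nat n))"
      by (rule sum.image_gen[OF \<open>finite A\<close>])
    also have "\<dots> = (\<Sum>\<kappa>\<in>b ` A. \<kappa> ^ n * poly (\<Sum>i | i \<in> A \<and> b i = \<kappa>. p i) (of_nat n))"
      by (simp add: poly_sum sum_distrib_left)
    finally show "(\<Sum>\<kappa>\<in>b ` A. \<kappa> ^ n * poly (\<Sum>i | i \<in> A \<and> b i = \<kappa>. p i) (of_nat n)) = 0" ..
  qed (use assms \<open>\<kappa> \<in> b ` A\<close> in auto)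
  then have "poly (\<Sum>i | i \<in> A \<and> b i = \<kappa>. p i) x = 0" by simp
  with l(2) p show False by (simp add: l.sum poly_sum)
qed

section \<open>Families of functions depending polynomially on a parameter\<close>

text \<open>A family \<open>U\<close> of polynomial functions indexed by complex numbers that is a polynomial in the index,
  with polynomial functions as coefficients.\<close>
definition poly_family :: "nat \<Rightarrow> (complex \<Rightarrow> 'v::ab_group_add \<Rightarrow> 'v) \<Rightarrow> (complex \<Rightarrow> point \<Rightarrow> 'v) \<Rightarrow> bool" where
  "poly_family r scale U \<longleftrightarrow> (\<exists>d C. (\<forall>j. C j \<in> polyfuns r scale) \<and>
     (\<forall>a z. U a z = (\<Sum>j<d. scale (a ^ j) (C (j::nat) z))))"

context
  fixes scale :: "complex \<Rightarrow> 'v::ab_group_add \<Rightarrow> 'v"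
  assumes vs: "vector_space scale"
begin

interpretation vector_space scale by (rule vs)

lemma poly_family_const: "F \<in> polyfuns r scale \<Longrightarrow> poly_family r scale (\<lambda>a. F)"
  unfolding poly_family_def by (intro exI[of _ 1] exI[of _ "\<lambda>_. F"]) simp

lemma poly_family_pad:
  assumes "poly_family r scale U"
  shows "\<exists>d C. (\<forall>j. C j \<in> polyfuns r scale) \<and> (\<forall>e\<ge>d. \<forall>a z. U a z = (\<Sum>j<e. scale (a ^ j) (C (j::nat) z)))"
proof -
  from assms obtain d C where C: "\<And>j. C j \<in> polyfuns r scale" "\<And>a z. U a z = (\<Sum>j<d. scale (a ^ j) (C j z))"
    unfolding poly_family_def by blast
  let ?C = "\<lambda>j. if j < d then C j else (\<lambda>z. 0)"
  have "(\<Sum>j<e. scale (a ^ j) (?C j z)) = U a z" if "e \<ge> d" for e a z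
  proof -
    have "(\<Sum>j<d. scale (a ^ j) (C j z)) = (\<Sum>j<e. scale (a ^ j) (?C j z))"
      using that by (intro sum.mono_neutral_cong_left) auto
    then show ?thesis using C(2) by simp
  qed
  then show ?thesis using C(1)
    by (intro exI[of _ d] exI[of _ ?C]) (auto intro: polyfuns.const)
qed

lemma poly_family_add:
  assumes "poly_family r scale U" "poly_family r scale U'"
  shows "poly_family r scale (\<lambda>a z. U a z + U' a z)"
proof -
  from poly_family_pad[OF assms(1)] obtain d C where C: "\<And>j. C j \<in> polyfuns r scale"
    "\<And>e a z. e \<ge> d \<Longrightarrow> U a z = (\<Sum>j<e. scale (a ^ j) (C j z))" by blast
  from poly_family_pad[OF assms(2)] obtain d' C' where C': "\<And>j. C' j \<in> polyfuns r scale"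
    "\<And>e a z. e \<ge> d' \<Longrightarrow> U' a z = (\<Sum>j<e. scale (a ^ j) (C' j z))" by blast
  have "U a z + U' a z = (\<Sum>j<max d d'. scale (a ^ j) (C j z + C' j z))" for a z
    using C(2)[of "max d d'" a z] C'(2)[of "max d d'" a z] by (simp add: scale_right_distrib sum.distrib)
  then show ?thesis unfolding poly_family_def
    using C(1) C'(1) by (intro exI[of _ "max d d'"] exI[of _ "\<lambda>j z. C j z + C' j z"]) (auto intro: polyfuns.add)
qed

lemma poly_family_scale:
  assumes "poly_family r scale U"
  shows "poly_family r scale (\<lambda>a z. scale c (U a z))"
proof -
  from assms obtain d C where C: "\<And>j. C j \<in> polyfuns r scale" "\<And>a z. U a z = (\<Sum>j<d. scale (a ^ j) (C j z))"
    unfolding poly_family_def by blast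
  then have "scale c (U a z) = (\<Sum>j<d. scale (a ^ j) (scale c (C j z)))" for a z
    by (simp add: scale_sum_right mult.commute)
  then show ?thesis unfolding poly_family_def
    using C(1) by (intro exI[of _ d] exI[of _ "\<lambda>j z. scale c (C j z)"]) (auto intro: polyfuns_scale[OF vs])
qed

lemma poly_family_mult_ev:
  assumes "poly_family r scale U" "i < r"
  shows "poly_family r scale (\<lambda>a z. scale (ev f (z i)) (U a z))"
proof -
  from assms obtain d C where C: "\<And>j. C j \<in> polyfuns r scale" "\<And>a z. U a z = (\<Sum>j<d. scale (a ^ j) (C j z))"
    unfolding poly_family_def by blast
  then have "scale (ev f (z i)) (U a z) = (\<Sum>j<d. scale (a ^ j) (scale (ev f (z i)) (C j z)))" for a z
    by (simp add: scale_sum_right mult.commute)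
  then show ?thesis unfolding poly_family_def
    using C(1) assms(2)
    by (intro exI[of _ d] exI[of _ "\<lambda>j z. scale (ev f (z i)) (C j z)"]) (auto intro: polyfuns_mult_ev[OF vs])
qed

lemma poly_family_mult_var:
  assumes "poly_family r scale U"
  shows "poly_family r scale (\<lambda>a z. scale a (U a z))"
proof -
  from assms obtain d C where C: "\<And>j. C j \<in> polyfuns r scale" "\<And>a z. U a z = (\<Sum>j<d. scale (a ^ j) (C j z))"
    unfolding poly_family_def by blast
  have "scale a (U a z) = (\<Sum>j<Suc d. scale (a ^ j) ((case j of 0 \<Rightarrow> \<lambda>z. 0 | Suc j \<Rightarrow> C j) z))" for a z
    unfolding sum.lessThan_Suc_shift C(2) scale_sum_right by simp
  then show ?thesis unfolding poly_family_def
    using C(1) by (intro exI[of _ "Suc d"] exI[of _ "case_nat (\<lambda>z. 0) C"])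
      (auto intro: polyfuns.const split: nat.splits)
qed

lemma poly_family_shift:
  assumes "F \<in> polyfuns r scale" "i < r"
  shows "poly_family r scale (\<lambda>a z. F (z(i := pshift X a (z i))))"
  using assms(1)
proof induction
  case (mult_fst F k)
  have *: "scale (fst ((z(i := pshift X a (z i))) k)) v =
      scale (ev var1 (z k)) v + scale (if k = i then - 1 else 0) (scale a v)" for a z v
    by (cases X) (auto simp: scale_left_diff_distrib)
  show ?case unfolding *
    by (intro poly_family_add poly_family_scale poly_family_mult_var poly_family_mult_ev mult_fst)
next
  case (mult_snd F k)
  define e where "e = (if k = i then snd (pshift X 0 (0, 0)) else 0)"
  have *: "scale (snd ((z(i := pshift X a (z i))) k)) v = scale (ev var2 (z k)) v + scale e v" for a z v
    by (cases X) (auto simp: e_def scale_left_diff_distrib scale_left_distrib)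
  show ?case unfolding *
    by (intro poly_family_add poly_family_scale poly_family_mult_ev mult_snd)
qed (auto intro: poly_family_const poly_family_add polyfuns.const)

lemma poly_family_facop:
  assumes "F \<in> polyfuns r scale" "i < r"
  shows "poly_family r scale (\<lambda>a. facop scale par X a i F)"
proof -
  obtain om l s e where q: "par i = (om, l, s, e)" by (cases "par i")
  note shift = poly_family_shift[OF assms]
  show ?thesis
  proof (cases X)
    case KL
    have *: "scale (pcoef (par i) KL a (z i)) v =
        scale (ev var1 (z i)) v + scale a (scale (if om then - 1 else 1) (scale (ev var2 (z i)) v) + scale e v)" for a z v
      by (simp add: q scale_left_distrib scale_left_diff_distrib scale_right_distrib)
    show ?thesis unfolding facop_def[abs_def] KL *
      by (intro poly_family_add poly_family_scale poly_family_mult_var poly_family_mult_ev shift assms(2))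
  next
    case KH
    have *: "scale (pcoef (par i) KH a (z i)) v = scale (ev var2 (z i)) v" for a z v
      by (simp add: q)
    show ?thesis unfolding facop_def[abs_def] KH *
      by (intro poly_family_mult_ev shift assms(2))
  qed (use poly_family_scale[OF shift[of KI], of s] poly_family_scale[OF shift[of KJ], of s]
      poly_family_const[OF polyfuns.const[of 0]] in \<open>simp_all add: facop_def[abs_def] q\<close>)
qed

lemma poly_family_vpoly: "poly_family r scale U \<Longrightarrow> vpoly scale (\<lambda>a. U a z)"
  unfolding poly_family_def vpoly_def by (elim exE conjE) (rule exI, rule exI, rule allI, erule allE, erule spec)

lemma poly_family_mem: "poly_family r scale U \<Longrightarrow> U a \<in> polyfuns r scale"
proof -
  assume "poly_family r scale U"
  then obtain d C where C: "\<And>j. C j \<in> polyfuns r scale" "\<And>a z. U a z = (\<Sum>j<d. scale (a ^ j) (C j z))"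
    unfolding poly_family_def by blast
  then have "U a = (\<lambda>z. \<Sum>j<d. scale (a ^ j) (C j z))" by blast
  with C(1) show ?thesis by (simp add: polyfuns_sum polyfuns_scale[OF vs])
qed

lemmas facop_mem = poly_family_mem[OF poly_family_facop]

text \<open>On a line in the direction of the second variable of one coordinate, a polynomial function is a
  polynomial.\<close>
lemma polyfuns_line:
  assumes "F \<in> polyfuns r scale"
  shows "vpoly scale (\<lambda>a. F (z(i := (fst (z i), snd (z i) + a * c))))"
proof -
  have "poly_family r scale (\<lambda>a y. F (z(i := (fst (z i), snd (z i) + a * c))))"
    using assms
  proof induction
    case (mult_fst F k)
    have *: "fst ((z(i := (fst (z i), snd (z i) + a * c))) k) = fst (z k)" for a by simp
    show ?case unfolding * by (intro poly_family_scale mult_fst)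
  next
    case (mult_snd F k)
    have *: "scale (snd ((z(i := (fst (z i), snd (z i) + a * c))) k)) v =
      scale (snd (z k)) v + scale (if k = i then c else 0) (scale a v)" for a v
      by (simp add: scale_left_distrib mult.commute)
    show ?case unfolding *
      by (intro poly_family_add poly_family_scale poly_family_mult_var mult_snd)
  qed (auto intro: poly_family_const poly_family_add polyfuns.const)
  then show ?thesis by (rule poly_family_vpoly)
qed

end

section \<open>Isomorphisms of modules of polynomial functions\<close>

text \<open>The values of a polynomial function span a finite-dimensional space, so one bound on the degree
  serves for all points.\<close>
lemma restricted_eventually_zero:
  assumes "restricted_gca_module scale act" "F \<in> polyfuns r scale"
  shows "\<exists>n0. \<forall>n\<ge>n0. \<forall>X z. act (Poly_Mapping.single (bas X (int n)) 1) (F z) = 0"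
proof -
  from assms(1) interpret gca_module scale act by (simp add: restricted_gca_module_def)
  interpret l: Vector_Spaces.linear scale scale "act x" for x by (rule linear_right)
  have in_graded: "Poly_Mapping.single (bas X n) 1 \<in> gca_graded n" for X n
    unfolding gca_graded_def by (rule pm.span_base) (cases X; simp)
  from assms(2) show ?thesis
  proof induction
    case (const w)
    from assms(1) obtain i :: nat where i: "\<forall>n\<ge>int i. \<forall>x\<in>gca_graded n. act x w = 0"
      unfolding restricted_gca_module_def by blast
    show ?case by (intro exI[of _ i]) (auto intro!: i[rule_format, OF _ in_graded])
  next
    case (add F G)
    then obtain n1 n2 where n: "\<forall>n\<ge>n1. \<forall>X z. act (Poly_Mapping.single (bas X (int n)) 1) (F z) = 0"
      "\<forall>n\<ge>n2. \<forall>X z. act (Poly_Mapping.single (bas X (int n)) 1) (G z) = 0" by blast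
    then show ?case by (intro exI[of _ "max n1 n2"]) (simp add: l.add)
  qed (auto simp: l.scale)
qed

lemma act_expand:
  assumes "gca_module scale act"
  shows "act x v = (\<Sum>b\<in>Poly_Mapping.keys x. scale (Poly_Mapping.lookup x b) (act (Poly_Mapping.single b 1) v))"
proof -
  interpret gca_module scale act by fact
  interpret l: Vector_Spaces.linear pm_scale scale "\<lambda>x. act x v" by (rule linear_left)
  have "x = (\<Sum>b\<in>Poly_Mapping.keys x. pm_scale (Poly_Mapping.lookup x b) (Poly_Mapping.single b 1))"
    by (rule poly_mapping_eqI)
      (simp add: lookup_sum lookup_single when_def in_keys_iff if_distrib[of "(*) _"] sum.delta cong: if_cong)
  from arg_cong[OF this, of "\<lambda>x. act x v"] show ?thesis
    by (simp only: l.sum l.scale)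
qed

lemma fun_act_bas:
  assumes "gca_module scale act"
  shows "fun_act r par scale act (Poly_Mapping.single (bas X n) 1) F z =
    (\<Sum>i<r. scale (base (par i) powi n) (facop scale par X (of_int n) i F z)) +
    act (Poly_Mapping.single (bas X n) 1) (F z)"
proof -
  interpret gca_module scale act by fact
  show ?thesis by (simp add: fun_act_def lin_ext_single[OF vector_space_axioms])
qed

lemma poly_quasi_periodic:
  fixes q :: "complex poly"
  assumes q: "q \<noteq> 0" and per: "\<And>x. poly q (x + 1) = \<rho> * poly q x"
  shows "\<rho> = 1" "poly q x = poly q y"
proof -
  have "poly (pcompose q [:1, 1:]) = poly (smult \<rho> q)"
    using per by (auto simp: poly_pcompose fun_eq_iff add.commute)
  then have eq: "pcompose q [:1, 1:] = smult \<rho> q" by (simp add: poly_eq_poly_eq_iff)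
  have "lead_coeff (pcompose q [:1, 1:]) = lead_coeff q"
    by (subst lead_coeff_comp) simp_all
  moreover have "degree (pcompose q [:1, 1:]) = degree q"
    by (simp add: degree_pcompose)
  ultimately show \<rho>: "\<rho> = 1" using q by (simp add: eq)
  have nat: "poly q (of_nat n) = poly q 0" for n
  proof (induction n)
    case (Suc n)
    with per[of "of_nat n"] \<rho> show ?case by (simp add: add.commute)
  qed simp
  have "q - [:poly q 0:] = 0"
  proof (rule ccontr)
    assume "q - [:poly q 0:] \<noteq> 0"
    then have "finite {x. poly (q - [:poly q 0:]) x = 0}" by (rule poly_roots_finite)
    moreover have "range of_nat \<subseteq> {x. poly (q - [:poly q 0:]) x = 0}" by (auto simp: nat)
    ultimately have "finite (range (of_nat :: nat \<Rightarrow> complex))" by (rule rev_finite_subset)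
    then show False by (simp add: finite_image_iff inj_on_def)
  qed
  then have "q = [:poly q 0:]" by simp
  from arg_cong[OF this, of poly] have "poly q x = poly q 0" for x by (simp add: fun_eq_iff)
  then show "poly q x = poly q y" by metis
qed

lemma vpoly_quasi_periodic:
  fixes scale :: "complex \<Rightarrow> 'v::ab_group_add \<Rightarrow> 'v"
  assumes vs: "vector_space scale" and u: "vpoly scale u"
    and per: "\<And>x. u (x + 1) = scale \<rho> (u x)"
  shows "u x \<noteq> 0 \<Longrightarrow> \<rho> = 1" "u x = u y"
proof -
  interpret vector_space scale by fact
  have fun_per: "poly p (x + 1) = \<rho> * poly p x"
    if "Vector_Spaces.linear scale (*) l" "\<And>a. l (u a) = poly p a" for l p x
  proof -
    interpret l: Vector_Spaces.linear scale "(*)" l by fact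
    from arg_cong[OF per[of x], of l] show ?thesis by (simp add: l.scale that(2))
  qed
  show "\<rho> = 1" if nz: "u x \<noteq> 0"
  proof -
    obtain l where l: "Vector_Spaces.linear scale (*) l" "l (u x) \<noteq> (0::complex)"
      by (rule ex_separating_functional[OF vs nz])
    obtain p where p: "\<And>a. l (u a) = poly p a" by (metis vpoly_functional[OF u l(1)])
    have "p \<noteq> 0" using p[of x] l(2) by auto
    from poly_quasi_periodic(1)[OF this fun_per[OF l(1) p]] show ?thesis .
  qed
  show "u x = u y"
  proof (rule ccontr)
    assume "u x \<noteq> u y"
    then have "u x - u y \<noteq> 0" by simp
    then obtain l where l: "Vector_Spaces.linear scale (*) l" "l (u x - u y) \<noteq> (0::complex)"
      by (rule ex_separating_functional[OF vs])
    interpret l: Vector_Spaces.linear scale "(*)" l by fact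
    obtain p where p: "\<And>a. l (u a) = poly p a" by (metis vpoly_functional[OF u l(1)])
    have "poly p x \<noteq> poly p y" using l(2) by (simp add: l.diff p)
    moreover from this have "p \<noteq> 0" by auto
    ultimately show False using poly_quasi_periodic(2)[OF _ fun_per[OF l(1) p]] by blast
  qed
qed

text \<open>An isomorphism \<open>f\<close> between two modules of polynomial functions, whose factors have parameters
  \<open>par i\<close> and \<open>qar j\<close>.\<close>
locale fun_iso =
  V: gca_module scaleV actV + W: gca_module scaleW actW
  for scaleV :: "complex \<Rightarrow> 'v::ab_group_add \<Rightarrow> 'v" and actV
    and scaleW :: "complex \<Rightarrow> 'w::ab_group_add \<Rightarrow> 'w" and actW +
  fixes r s :: nat and par qar :: "nat \<Rightarrow> param" and f :: "(point \<Rightarrow> 'v) \<Rightarrow> point \<Rightarrow> 'w"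
  assumes restrictedV: "restricted_gca_module scaleV actV"
    and restrictedW: "restricted_gca_module scaleW actW"
    and par: "i < r \<Longrightarrow> base (par i) \<noteq> 0" "i < r \<Longrightarrow> weight (par i) \<noteq> 0"
    and qar: "j < s \<Longrightarrow> base (qar j) \<noteq> 0" "j < s \<Longrightarrow> weight (qar j) \<noteq> 0"
    and inj_par: "inj_on (\<lambda>i. base (par i)) {..<r}"
    and inj_qar: "inj_on (\<lambda>j. base (qar j)) {..<s}"
    and bij: "bij_betw f (polyfuns r scaleV) (polyfuns s scaleW)"
    and f_add: "F \<in> polyfuns r scaleV \<Longrightarrow> G \<in> polyfuns r scaleV \<Longrightarrow> f (\<lambda>z. F z + G z) = (\<lambda>z. f F z + f G z)"
    and f_scale: "F \<in> polyfuns r scaleV \<Longrightarrow> f (\<lambda>z. scaleV c (F z)) = (\<lambda>z. scaleW c (f F z))"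
    and f_act: "F \<in> polyfuns r scaleV \<Longrightarrow> f (fun_act r par scaleV actV x F) = fun_act s qar scaleW actW x (f F)"
begin

abbreviation "PV \<equiv> polyfuns r scaleV"
abbreviation "PW \<equiv> polyfuns s scaleW"

lemmas vsV = V.vector_space_axioms
lemmas vsW = W.vector_space_axioms

lemma f_mem: "F \<in> PV \<Longrightarrow> f F \<in> PW"
  using bij_betwE[OF bij] by blast

lemma f_inj: "F \<in> PV \<Longrightarrow> G \<in> PV \<Longrightarrow> f F = f G \<Longrightarrow> F = G"
  using bij unfolding bij_betw_def inj_on_def by blast

lemma f_zero: "f (\<lambda>z. 0) = (\<lambda>z. 0)"
  using f_scale[OF polyfuns.const[of 0], of 0] by simp

lemma f_eq_zero: "F \<in> PV \<Longrightarrow> f F = (\<lambda>z. 0) \<Longrightarrow> F z = 0"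
  using f_inj[OF _ polyfuns.const[of 0]] f_zero by metis

lemma f_sum:
  assumes "\<And>k. k \<in> K \<Longrightarrow> F k \<in> PV"
  shows "f (\<lambda>z. \<Sum>k\<in>K. scaleV (c k) (F k z)) = (\<lambda>z. \<Sum>k\<in>K. scaleW (c k) (f (F k) z))"
  using assms
proof (induction K rule: infinite_finite_induct)
  case (insert k K)
  then have "(\<lambda>z. \<Sum>k\<in>K. scaleV (c k) (F k z)) \<in> PV" "(\<lambda>z. scaleV (c k) (F k z)) \<in> PV"
    by (auto intro!: polyfuns_sum polyfuns_scale[OF vsV])
  with insert show ?case by (simp add: f_add f_scale)
qed (simp_all add: f_zero)

lemma f_poly_family:
  assumes "poly_family r scaleV U"
  shows "poly_family s scaleW (\<lambda>a. f (U a))"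
proof -
  from assms obtain d C where C: "\<And>j. C j \<in> PV" "\<And>a z. U a z = (\<Sum>j<d. scaleV (a ^ j) (C j z))"
    unfolding poly_family_def by blast
  then have "U a = (\<lambda>z. \<Sum>j<d. scaleV (a ^ j) (C j z))" for a by blast
  then have "f (U a) z = (\<Sum>j<d. scaleW (a ^ j) (f (C j) z))" for a z
    using f_sum[of "{..<d}" C "\<lambda>j. a ^ j"] C(1) by simp
  with f_mem[OF C(1)] show ?thesis
    unfolding poly_family_def by (intro exI[of _ d] exI[of _ "\<lambda>j. f (C j)"]) simp
qed

text \<open>The key step.  For large \<open>n\<close>, a basis element of degree \<open>n\<close> acts on both sides as a sum of terms
  \<open>\<kappa>\<^sup>n\<close> times a polynomial in \<open>n\<close>, because the modules \<open>V\<close> and \<open>W\<close> are restricted.  Comparing the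
  polynomials that belong to \<open>\<kappa>\<close> shows that \<open>f\<close> is compatible with the operators on the single factors,
  for every complex \<open>a\<close>.\<close>
lemma intertwine:
  assumes F: "F \<in> PV"
  shows "(\<Sum>i | i < r \<and> base (par i) = \<kappa>. f (facop scaleV par X a i F) z) =
    (\<Sum>j | j < s \<and> base (qar j) = \<kappa>. facop scaleW qar X a j (f F) z)"
proof -
  note G = f_mem[OF F]
  obtain n1 where n1: "\<And>n X z. n \<ge> n1 \<Longrightarrow> actV (Poly_Mapping.single (bas X (int n)) 1) (F z) = 0"
    using restricted_eventually_zero[OF restrictedV F] by blast
  obtain n2 where n2: "\<And>n X z. n \<ge> n2 \<Longrightarrow> actW (Poly_Mapping.single (bas X (int n)) 1) (f F z) = 0"
    using restricted_eventually_zero[OF restrictedW G] by blast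
  define A where "A = {..<r} <+> {..<s}"
  define b where "b = case_sum (\<lambda>i. base (par i)) (\<lambda>j. base (qar j))"
  define u where "u = case_sum (\<lambda>i a. f (facop scaleV par X a i F) z)
    (\<lambda>j a. scaleW (-1) (facop scaleW qar X a j (f F) z))"
  have "(\<Sum>x | x \<in> A \<and> b x = \<kappa>. u x a) = 0"
  proof (rule exp_vpoly_independent[OF vsW, of A b u "max n1 n2"])
    show "finite A" by (simp add: A_def)
    show "b x \<noteq> 0" if "x \<in> A" for x
      using that by (auto simp: A_def b_def par qar)
    show "vpoly scaleW (u x)" if "x \<in> A" for x
      using that poly_family_vpoly[OF vsW f_poly_family[OF poly_family_facop[OF vsV F]]]
        poly_family_vpoly[OF vsW poly_family_scale[OF vsW poly_family_facop[OF vsW G], where c = "-1"]]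
      by (auto simp: A_def u_def)
    fix n assume n: "n \<ge> max n1 n2"
    let ?x = "Poly_Mapping.single (bas X (int n)) 1"
    have "fun_act r par scaleV actV ?x F =
        (\<lambda>z. \<Sum>i<r. scaleV (base (par i) ^ n) (facop scaleV par X (of_nat n) i F z))"
      using n1[of n] n by (simp add: fun_act_bas[OF V.gca_module_axioms] fun_eq_iff)
    moreover have "fun_act s qar scaleW actW ?x (f F) z =
        (\<Sum>j<s. scaleW (base (qar j) ^ n) (facop scaleW qar X (of_nat n) j (f F) z))"
      using n2[of n] n by (simp add: fun_act_bas[OF W.gca_module_axioms])
    ultimately have "(\<Sum>i<r. scaleW (base (par i) ^ n) (f (facop scaleV par X (of_nat n) i F) z)) =
        (\<Sum>j<s. scaleW (base (qar j) ^ n) (facop scaleW qar X (of_nat n) j (f F) z))"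
      using fun_cong[OF f_act[OF F, of ?x], of z] facop_mem[OF vsV F] fun_cong[OF f_sum[of "{..<r}"
          "\<lambda>i. facop scaleV par X (of_nat n) i F" "\<lambda>i. base (par i) ^ n"], of z]
      by simp
    then show "(\<Sum>x\<in>A. scaleW (b x ^ n) (u x (of_nat n))) = 0"
      by (simp add: A_def sum.Plus b_def u_def sum_negf)
  qed
  moreover have "{x. x \<in> A \<and> b x = \<kappa>} = {i. i < r \<and> base (par i) = \<kappa>} <+> {j. j < s \<and> base (qar j) = \<kappa>}"
    by (auto simp: A_def b_def)
  ultimately show ?thesis by (simp add: sum.Plus u_def sum_negf)
qed

lemma par_fiber: "i < r \<Longrightarrow> {i'. i' < r \<and> base (par i') = base (par i)} = {i}"
  using inj_par by (auto simp: inj_on_def)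

lemma qar_fiber: "j < s \<Longrightarrow> {j'. j' < s \<and> base (qar j') = base (qar j)} = {j}"
  using inj_qar by (auto simp: inj_on_def)

lemma intertwine_match:
  assumes "F \<in> PV" "i < r" "j < s" "base (par i) = base (qar j)"
  shows "f (facop scaleV par X a i F) = facop scaleW qar X a j (f F)"
  using intertwine[OF assms(1), where \<kappa> = "base (qar j)" and X = X and a = a] par_fiber[OF assms(2)] qar_fiber[OF assms(3)] assms(4)
  by (auto simp: fun_eq_iff)

text \<open>Each base on the left occurs on the right, as the operator of \<open>H\<^sub>0\<close> on a factor is multiplication by
  \<open>t\<^sub>i\<close> and does not annihilate a nonzero constant.\<close>
lemma ex_match:
  assumes v: "v \<noteq> (0::'v)" and i: "i < r"
  shows "\<exists>j<s. base (par i) = base (qar j)"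
proof (rule ccontr)
  assume "\<not> ?thesis"
  then have *: "{j. j < s \<and> base (qar j) = base (par i)} = {}" by auto
  have "f (facop scaleV par KH 0 i (\<lambda>z. v)) = (\<lambda>z. 0)"
    using intertwine[OF polyfuns.const[of v], where \<kappa> = "base (par i)" and X = KH and a = 0] par_fiber[OF i]
    unfolding * by (auto simp: fun_eq_iff)
  then have "facop scaleV par KH 0 i (\<lambda>z. v) (\<lambda>_. (0, 1)) = 0"
    by (rule f_eq_zero[OF facop_mem[OF vsV polyfuns.const i]])
  with v show False by (cases "par i") (simp add: facop_def)
qed

lemma ex_match':
  assumes w: "w \<noteq> (0::'w)" and j: "j < s"
  shows "\<exists>i<r. base (par i) = base (qar j)"
proof (rule ccontr)
  assume "\<not> ?thesis"
  then have *: "{i. i < r \<and> base (par i) = base (qar j)} = {}" by auto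
  obtain F where F: "F \<in> PV" "f F = (\<lambda>z. w)"
    using bij_betw_imp_surj_on[OF bij] polyfuns.const[of w s scaleW] by (metis imageE)
  have "facop scaleW qar KH 0 j (\<lambda>z. w) (\<lambda>_. (0, 1)) = 0"
    using intertwine[OF F(1), where \<kappa> = "base (qar j)" and X = KH and a = 0] F(2) * qar_fiber[OF j] by simp
  with w show False by (cases "qar j") (simp add: facop_def)
qed

context
  fixes i j v
  assumes i: "i < r" and j: "j < s" and base_eq: "base (par i) = base (qar j)" and v: "v \<noteq> (0::'v)"
begin

lemma f_const_nonzero: "\<exists>z. f (\<lambda>z. v) z \<noteq> 0"
  using f_eq_zero[OF polyfuns.const, of v] v by blast

text \<open>\<open>I\<close> acts as zero on \<open>\<Gamma>\<close>, \<open>J\<close> acts as zero on \<open>\<Omega>\<close>, and neither annihilates a nonzero constant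
  on the other type of factor.\<close>
lemma match_kind: "fst (par i) = fst (qar j)"
proof -
  obtain om l s' e where p: "par i = (om, l, s', e)" by (cases "par i")
  obtain om' l' t e' where q: "qar j = (om', l', t, e')" by (cases "qar j")
  have s: "s' \<noteq> 0" using par(2)[OF i] p by (simp add: weight_def)
  note m = intertwine_match[OF polyfuns.const[of v] i j base_eq]
  have nz: "f (\<lambda>z. scaleV s' v) \<noteq> (\<lambda>z. 0)"
    using f_eq_zero[OF polyfuns.const, of "scaleV s' v"] s v by auto
  from m[of KI 0] m[of KJ 0] nz show ?thesis
    by (cases om; cases om') (simp_all add: facop_def[abs_def] p q)
qed

text \<open>The kind of the basis elements that act on the \<open>i\<close>-th factor as a multiple of a shift.\<close>
definition "shift_kind = (if fst (par i) then KI else KJ)"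

lemma f_const_shift:
  "scaleW (weight (par i)) (f (\<lambda>z. v) z) = scaleW (weight (qar j)) (f (\<lambda>z. v) (z(j := pshift shift_kind a (z j))))"
proof -
  obtain om l s' e where p: "par i = (om, l, s', e)" by (cases "par i")
  obtain om' l' t e' where q: "qar j = (om', l', t, e')" by (cases "qar j")
  have om: "om' = om" using match_kind p q by simp
  have c: "pcoef (par i) shift_kind a y = weight (par i)" "pcoef (qar j) shift_kind a y = weight (qar j)" for y
    by (cases om; simp add: shift_kind_def p q om weight_def)+
  have "f (\<lambda>z. scaleV (weight (par i)) v) z = facop scaleW qar shift_kind a j (f (\<lambda>z. v)) z"
    using intertwine_match[OF polyfuns.const[of v] i j base_eq, of shift_kind a]
    by (simp add: facop_def[of scaleV, abs_def] c)
  then show ?thesis by (simp add: f_scale[OF polyfuns.const] facop_def c)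
qed

text \<open>On a nonzero constant \<open>v\<close> these shifts act as the scalar \<open>\<sigma>\<close>, so the image \<open>G\<close> of \<open>v\<close> is multiplied by
  a scalar when \<open>t\<^sub>j\<close> is shifted by \<open>1\<close>.  A nonzero polynomial with this property is constant, with scalar
  \<open>1\<close>.  The arbitrary shift of \<open>s\<^sub>j\<close> then shows that \<open>G\<close> does not depend on \<open>s\<^sub>j\<close> either.\<close>
lemma
  shows match_weight: "weight (par i) = weight (qar j)"
    and f_const_coord: "f (\<lambda>z. v) (z(j := y)) = f (\<lambda>z. v) z"
proof -
  let ?G = "f (\<lambda>z. v)"
  define c :: complex where "c = (if fst (par i) then - 1 else 1)"
  have sh: "pshift shift_kind a y = (fst y - a, snd y + c)" for a y by (simp add: shift_kind_def c_def)
  have w: "weight (qar j) \<noteq> 0" using qar j by blast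
  define u where "u z x = ?G (z(j := (fst (z j), snd (z j) + x * c)))" for z x
  have upoly: "vpoly scaleW (u z)" for z
    unfolding u_def by (rule polyfuns_line[OF vsW f_mem[OF polyfuns.const]])
  have per: "u z (x + 1) = scaleW (weight (par i) / weight (qar j)) (u z x)" for z x
    using arg_cong[OF f_const_shift[of "z(j := (fst (z j), snd (z j) + x * c))" 0], of "scaleW (1 / weight (qar j))"] w
    by (simp add: u_def sh algebra_simps)
  obtain z0 where "?G z0 \<noteq> 0" using f_const_nonzero by blast
  then have "u z0 0 \<noteq> 0" by (simp add: u_def)
  from vpoly_quasi_periodic(1)[OF vsW upoly per this] w show *: "weight (par i) = weight (qar j)"
    by simp
  have "?G z = ?G (z(j := pshift shift_kind a (z j)))" for z a
    using f_const_shift[of z a] w by (simp add: *)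
  then have shift: "?G (z(j := (fst (z j) - a, snd (z j) + c))) = ?G z" for z a by (simp add: sh)
  have uconst: "u z x = u z x'" for z x x'
    by (rule vpoly_quasi_periodic(2)[OF vsW upoly per])
  have snd: "?G (z(j := (fst (z j), t))) = ?G z" for z t
  proof -
    have "c * c = 1" by (simp add: c_def)
    then have "u z ((t - snd (z j)) * c) = ?G (z(j := (fst (z j), t)))" by (simp add: u_def mult.assoc)
    moreover have "u z 0 = ?G z" by (simp add: u_def)
    ultimately show ?thesis using uconst by metis
  qed
  have "?G z = ?G (z(j := (fst (z j) - (fst (z j) - fst y), snd (z j) + c)))"
    by (rule shift[symmetric])
  also have "\<dots> = ?G (z(j := (fst y, snd (z j) + c)))" by simp
  also have "\<dots> = ?G (z(j := y))"
    using snd[of "z(j := (fst y, snd (z j) + c))" "snd y"] by simp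
  finally show "?G (z(j := y)) = ?G z" ..
qed

end

text \<open>If every base on the right occurs on the left, the images of constant functions are constant; the
  value is written as that at an arbitrary point.\<close>
lemma f_const:
  assumes match: "\<And>j. j < s \<Longrightarrow> \<exists>i<r. base (par i) = base (qar j)"
  shows "f (\<lambda>z. v) = (\<lambda>z. f (\<lambda>z. v) z0)"
proof (cases "v = 0")
  case False
  let ?G = "f (\<lambda>z. v)"
  \<comment> \<open>replace the coordinates of \<open>z0\<close> by those of \<open>z\<close> one at a time\<close>
  have "?G (\<lambda>i. if i < k then z i else z0 i) = ?G z0" if "k \<le> s" for k z
    using that
  proof (induction k)
    case (Suc k)
    then obtain i where "i < r" "base (par i) = base (qar k)" using match[of k] by auto
    from f_const_coord[OF this(1) _ this(2) False, of "\<lambda>i. if i < k then z i else z0 i" "z k"] Suc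
    have "?G ((\<lambda>i. if i < k then z i else z0 i)(k := z k)) = ?G z0" by simp
    moreover have "(\<lambda>i. if i < k then z i else z0 i)(k := z k) = (\<lambda>i. if i < Suc k then z i else z0 i)"
      by (auto simp: fun_eq_iff less_Suc_eq)
    ultimately show ?case by simp
  qed simp
  moreover have "?G z = ?G (\<lambda>i. if i < s then z i else z0 i)" for z
    by (rule polyfuns_cong_coords[OF f_mem[OF polyfuns.const]]) simp
  ultimately show ?thesis by (metis order_refl)
qed (simp add: f_zero)

lemma match_param:
  assumes match: "\<And>j. j < s \<Longrightarrow> \<exists>i<r. base (par i) = base (qar j)"
    and i: "i < r" and j: "j < s" and base_eq: "base (par i) = base (qar j)" and v: "v \<noteq> (0::'v)"
  shows "par i = qar j"
proof -
  obtain om l s' e where p: "par i = (om, l, s', e)" by (cases "par i")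
  obtain om' l' t e' where q: "qar j = (om', l', t, e')" by (cases "qar j")
  have om: "om' = om" using match_kind[OF i j base_eq v] p q by simp
  have l: "l' = l" using base_eq p q by (simp add: base_def)
  have t: "t = s'" using match_weight[OF i j base_eq v] p q by (simp add: weight_def)
  obtain z where z: "f (\<lambda>z. v) z \<noteq> 0" using f_const_nonzero[OF i j base_eq v] by blast
  let ?F = "\<lambda>z :: point. v" and ?G = "f (\<lambda>z. v)"
  let ?d = "if om then - 1 else 1 :: complex"
  note mem = facop_mem[OF vsV polyfuns.const[of v] i, of par]
  have G: "?G y = ?G z" for y using f_const[OF match, of v z] by metis
  \<comment> \<open>On constants, \<open>\<eta>\<close> is what remains of the operator of \<open>L\<close> at \<open>a = 1\<close> after removing those of
    \<open>L\<close> and \<open>H\<close> at \<open>a = 0\<close>.\<close>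
  have L: "facop scaleV par KL 1 i ?F =
      (\<lambda>z. facop scaleV par KL 0 i ?F z + (scaleV ?d (facop scaleV par KH 0 i ?F z) + scaleV e v))"
    by (auto simp: facop_def p fun_eq_iff algebra_simps V.scale_left_distrib V.scale_left_diff_distrib)
  have "f (facop scaleV par KL 1 i ?F) = (\<lambda>z. f (facop scaleV par KL 0 i ?F) z + (scaleW ?d (f (facop scaleV par KH 0 i ?F) z)
      + scaleW e (?G z)))"
    unfolding L by (simp add: f_add f_scale mem polyfuns.const polyfuns.add polyfuns_scale[OF vsV])
  then have "facop scaleW qar KL 1 j ?G z =
      facop scaleW qar KL 0 j ?G z + (scaleW ?d (facop scaleW qar KH 0 j ?G z) + scaleW e (?G z))"
    by (simp add: intertwine_match[OF polyfuns.const i j base_eq])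
  then have "scaleW (pcoef (qar j) KL 1 (z j)) (?G z) =
     scaleW (pcoef (qar j) KL 0 (z j) + (?d * pcoef (qar j) KH 0 (z j) + e)) (?G z)"
    unfolding facop_def G[of "z(_ := _)"] by (simp only: W.scale_left_distrib W.scale_scale)
  then have "pcoef (qar j) KL 1 (z j) = pcoef (qar j) KL 0 (z j) + (?d * pcoef (qar j) KH 0 (z j) + e)"
    using z by simp
  then have "e' = e" by (auto simp: q om split: if_splits)
  with om l t p q show ?thesis by simp
qed

text \<open>The action on a constant splits into the contributions of the factors and that of the module \<open>V\<close>.
  By \<open>intertwine\<close>, \<open>f\<close> respects the former, hence also the latter.\<close>
lemma f_const_equivariant:
  assumes match: "\<And>j. j < s \<Longrightarrow> \<exists>i<r. base (par i) = base (qar j)"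
  shows "f (\<lambda>z. actV x v) z = actW x (f (\<lambda>z. v) z)"
proof -
  have basis: "f (\<lambda>z. actV (Poly_Mapping.single (bas X n) 1) v) z =
    actW (Poly_Mapping.single (bas X n) 1) (f (\<lambda>z. v) z)" for X n
  proof -
    let ?x = "Poly_Mapping.single (bas X n) 1" and ?F = "\<lambda>z :: point. v"
    let ?hV = "\<lambda>i. scaleW (base (par i) powi n) (f (facop scaleV par X (of_int n) i ?F) z)"
    let ?hW = "\<lambda>j. scaleW (base (qar j) powi n) (facop scaleW qar X (of_int n) j (f ?F) z)"
    define B where "B = (\<lambda>i. base (par i)) ` {..<r} \<union> (\<lambda>j. base (qar j)) ` {..<s}"
    have "(\<Sum>i<r. ?hV i) = (\<Sum>\<kappa>\<in>B. \<Sum>i | i \<in> {..<r} \<and> base (par i) = \<kappa>. ?hV i)"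
      by (rule sum.group[symmetric]) (auto simp: B_def)
    also have "\<dots> = (\<Sum>\<kappa>\<in>B. scaleW (\<kappa> powi n) (\<Sum>i | i < r \<and> base (par i) = \<kappa>. f (facop scaleV par X (of_int n) i ?F) z))"
      by (simp add: W.scale_sum_right)
    also have "\<dots> = (\<Sum>\<kappa>\<in>B. scaleW (\<kappa> powi n) (\<Sum>j | j < s \<and> base (qar j) = \<kappa>. facop scaleW qar X (of_int n) j (f ?F) z))"
      by (simp only: intertwine[OF polyfuns.const])
    also have "\<dots> = (\<Sum>\<kappa>\<in>B. \<Sum>j | j \<in> {..<s} \<and> base (qar j) = \<kappa>. ?hW j)"
      by (simp add: W.scale_sum_right)
    also have "\<dots> = (\<Sum>j<s. ?hW j)"
      by (rule sum.group) (auto simp: B_def)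
    finally have sums: "(\<Sum>i<r. ?hV i) = (\<Sum>j<s. ?hW j)" .
    have mem: "facop scaleV par X (of_int n) i ?F \<in> PV" if "i < r" for i
      by (rule facop_mem[OF vsV polyfuns.const that])
    have "fun_act r par scaleV actV ?x ?F =
        (\<lambda>z. (\<Sum>i<r. scaleV (base (par i) powi n) (facop scaleV par X (of_int n) i ?F z)) + actV ?x v)"
      by (simp add: fun_act_bas[OF V.gca_module_axioms] fun_eq_iff)
    note act = this
    have fs: "f (\<lambda>z. \<Sum>i<r. scaleV (base (par i) powi n) (facop scaleV par X (of_int n) i ?F z)) z =
        (\<Sum>i<r. ?hV i)"
      using mem fun_cong[OF f_sum[of "{..<r}" "\<lambda>i. facop scaleV par X (of_int n) i ?F"
          "\<lambda>i. base (par i) powi n"], of z] by simp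
    have "f (fun_act r par scaleV actV ?x ?F) z = (\<Sum>i<r. ?hV i) + f (\<lambda>z. actV ?x v) z"
      using mem by (subst act, subst f_add)
        (auto simp: fs polyfuns.const
          intro!: polyfuns_sum polyfuns_scale[OF vsV])
    moreover have "fun_act s qar scaleW actW ?x (f ?F) z = (\<Sum>j<s. ?hW j) + actW ?x (f ?F z)"
      by (simp add: fun_act_bas[OF W.gca_module_axioms])
    ultimately show ?thesis using f_act[OF polyfuns.const, of ?x v] sums by simp
  qed
  have basis': "f (\<lambda>z. actV (Poly_Mapping.single b 1) v) z = actW (Poly_Mapping.single b 1) (f (\<lambda>z. v) z)" for b
    using basis[of "kind_of b" "deg_of b"] by (simp add: bas_kind_deg)
  show ?thesis
    unfolding act_expand[OF V.gca_module_axioms, of x v] act_expand[OF W.gca_module_axioms, of x "f _ z"]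
    by (subst f_sum) (simp_all add: polyfuns.const basis')
qed

end

context fun_iso
begin

lemma image_par_eq:
  assumes "v \<noteq> (0::'v)" "w \<noteq> (0::'w)"
  shows "par ` {..<r} = qar ` {..<s}"
proof -
  have match: "\<exists>i<r. base (par i) = base (qar j)" if "j < s" for j
    by (rule ex_match'[OF assms(2) that])
  have "\<exists>j<s. par i = qar j" if i: "i < r" for i
    using ex_match[OF assms(1) i] match_param[OF match i _ _ assms(1)] by blast
  moreover have "\<exists>i<r. par i = qar j" if j: "j < s" for j
    using match[OF j] match_param[OF match _ j _ assms(1)] by blast
  ultimately show ?thesis by (auto simp: image_iff) (metis lessThan_iff)+
qed

text \<open>The restriction of \<open>f\<close> to constants is an injective homomorphism from \<open>V\<close> to \<open>W\<close>; its image is a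
  nonzero submodule, which is all of \<open>W\<close> by simplicity.\<close>
lemma iso_type_struct:
  assumes v: "v \<noteq> (0::'v)" and simple: "simple_gca_module scaleW actW"
  shows "gca_iso (type_struct scaleV actV) (type_struct scaleW actW)"
proof -
  from simple obtain w :: 'w where w: "w \<noteq> 0" unfolding simple_gca_module_def by blast
  have match: "\<exists>i<r. base (par i) = base (qar j)" if "j < s" for j
    by (rule ex_match'[OF w that])
  define \<psi> where "\<psi> v = f (\<lambda>z. v) (\<lambda>_. (0, 0))" for v
  have f: "f (\<lambda>z. v) = (\<lambda>z. \<psi> v)" for v
    unfolding \<psi>_def by (rule f_const[OF match])
  have add: "\<psi> (u + v) = \<psi> u + \<psi> v" for u v
    using fun_cong[OF f_add[OF polyfuns.const[of u] polyfuns.const[of v]]] by (simp add: f)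
  have scal: "\<psi> (scaleV c v) = scaleW c (\<psi> v)" for c v
    using fun_cong[OF f_scale[OF polyfuns.const[of v], of c]] by (simp add: f)
  have act: "\<psi> (actV x v) = actW x (\<psi> v)" for x v
    using f_const_equivariant[OF match, of x v] by (simp add: f)
  have inj: "inj \<psi>"
  proof (rule injI)
    fix u v assume "\<psi> u = \<psi> v"
    then have "(\<lambda>z :: point. u) = (\<lambda>z. v)"
      by (intro f_inj polyfuns.const) (simp add: f)
    then show "u = v" by meson
  qed
  have zero: "\<psi> 0 = 0" using add[of 0 0] by simp
  have "range \<psi> = {0} \<or> range \<psi> = UNIV"
  proof -
    have "W.subspace (range \<psi>)"
      unfolding W.subspace_def
      by (auto simp flip: add scal intro: range_eqI[of _ _ 0] simp: zero)
    moreover have "\<forall>x. \<forall>u\<in>range \<psi>. actW x u \<in> range \<psi>" by (auto simp flip: act)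
    ultimately show ?thesis using simple unfolding simple_gca_module_def by blast
  qed
  moreover have "range \<psi> \<noteq> {0}"
    using v inj zero by (metis injD rangeI singletonD)
  ultimately have "bij \<psi>" using inj by (simp add: bij_def)
  then show ?thesis
    unfolding gca_iso_def type_struct_def
    by (intro exI[of _ \<psi>]) (simp add: add scal act)
qed

end

section \<open>Permuting the tensor factors\<close>

lemma polyfuns_reindex:
  assumes "F \<in> polyfuns r scale" "\<And>i. i < r \<Longrightarrow> \<pi> i < r"
  shows "(\<lambda>z. F (\<lambda>i. z (\<pi> i))) \<in> polyfuns r scale"
  using assms(1)
proof induction
  case (const w)
  show ?case by (rule polyfuns.const)
next
  case (add F G)
  from polyfuns.add[OF add.IH] show ?case .
next
  case (mult_fst F i)
  from polyfuns.mult_fst[OF mult_fst.IH assms(2)[OF mult_fst.hyps(2)]] show ?case .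
next
  case (mult_snd F i)
  from polyfuns.mult_snd[OF mult_snd.IH assms(2)[OF mult_snd.hyps(2)]] show ?case .
qed

lemma fun_struct_iso_reindex:
  assumes V: "gca_module scaleV actV" and W: "gca_module scaleW actW"
    and VW: "gca_iso (type_struct scaleV actV) (type_struct scaleW actW)"
    and \<pi>: "bij \<pi>" "\<And>i. \<pi> i < r \<longleftrightarrow> i < r"
    and par: "\<And>i. i < r \<Longrightarrow> par i = qar (\<pi> i)"
  shows "gca_iso (fun_struct r par scaleV actV) (fun_struct r qar scaleW actW)"
proof -
  interpret V: gca_module scaleV actV by fact
  interpret W: gca_module scaleW actW by fact
  from VW obtain \<psi> where \<psi>: "bij \<psi>" "\<And>u v. \<psi> (u + v) = \<psi> u + \<psi> v"
    "\<And>c v. \<psi> (scaleV c v) = scaleW c (\<psi> v)" "\<And>x v. \<psi> (actV x v) = actW x (\<psi> v)"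
    unfolding gca_iso_def type_struct_def by auto
  have lin: "Vector_Spaces.linear scaleV scaleW \<psi>"
    by (intro Vector_Spaces.linear.intro V.vector_space_axioms W.vector_space_axioms
        module_hom.intro V.module_axioms W.module_axioms module_hom_axioms.intro \<psi>)
  interpret l: Vector_Spaces.linear scaleV scaleW \<psi> by (rule lin)
  define \<psi>' where "\<psi>' = inv \<psi>"
  have inv: "\<psi>' (\<psi> v) = v" "\<psi> (\<psi>' w) = w" for v w
    using \<psi>(1) by (simp_all add: \<psi>'_def bij_is_inj bij_is_surj surj_f_inv_f)
  have lin': "Vector_Spaces.linear scaleW scaleV \<psi>'"
  proof (intro Vector_Spaces.linear.intro V.vector_space_axioms W.vector_space_axioms
        module_hom.intro V.module_axioms W.module_axioms module_hom_axioms.intro)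
    show "\<psi>' (u + v) = \<psi>' u + \<psi>' v" for u v using \<psi>(2) inv by metis
    show "\<psi>' (scaleW c v) = scaleV c (\<psi>' v)" for c v using \<psi>(3) inv by metis
  qed
  define \<pi>' where "\<pi>' = inv \<pi>"
  have \<pi>': "\<pi>' (\<pi> i) = i" "\<pi> (\<pi>' i) = i" for i
    using \<pi>(1) by (simp_all add: \<pi>'_def bij_is_inj bij_is_surj surj_f_inv_f)
  have \<pi>'r: "\<pi>' i < r" if "i < r" for i using \<pi>(2)[of "\<pi>' i"] that \<pi>'(2) by simp
  define \<Phi> where "\<Phi> F = (\<lambda>z :: point. \<psi> (F (\<lambda>i. z (\<pi> i))))" for F
  define \<Phi>' where "\<Phi>' G = (\<lambda>z :: point. \<psi>' (G (\<lambda>i. z (\<pi>' i))))" for G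
  have "bij_betw \<Phi> (polyfuns r scaleV) (polyfuns r scaleW)"
  proof (rule bij_betw_byWitness[where f' = \<Phi>'])
    show "\<forall>F\<in>polyfuns r scaleV. \<Phi>' (\<Phi> F) = F" "\<forall>G\<in>polyfuns r scaleW. \<Phi> (\<Phi>' G) = G"
      by (simp_all add: \<Phi>_def \<Phi>'_def inv \<pi>')
    show "\<Phi> ` polyfuns r scaleV \<subseteq> polyfuns r scaleW"
      using polyfuns_compose_linear[OF lin polyfuns_reindex[of _ r scaleV \<pi>]] \<pi>(2)
      by (auto simp: \<Phi>_def)
    show "\<Phi>' ` polyfuns r scaleW \<subseteq> polyfuns r scaleV"
      using polyfuns_compose_linear[OF lin' polyfuns_reindex[of _ r scaleW \<pi>']] \<pi>'r
      by (auto simp: \<Phi>'_def)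
  qed
  moreover have "\<Phi> (fun_act r par scaleV actV x F) = fun_act r qar scaleW actW x (\<Phi> F)" for x F
  proof
    fix z :: point
    have upd: "(\<lambda>k. (z(\<pi> i := y)) (\<pi> k)) = (\<lambda>k. z (\<pi> k))(i := y)" for i y
      using \<pi>'(1) by (auto simp: fun_eq_iff) metis
    have "(\<Sum>i<r. scaleW (base (par i) powi n) (\<psi> (facop scaleV par X a i F (\<lambda>k. z (\<pi> k))))) =
      (\<Sum>j<r. scaleW (base (qar j) powi n) (facop scaleW qar X a j (\<Phi> F) z))" for X a n
    proof (rule sum.reindex_bij_witness[of _ \<pi>' \<pi>])
      fix i assume "i \<in> {..<r}"
      then show "scaleW (base (qar (\<pi> i)) powi n) (facop scaleW qar X a (\<pi> i) (\<Phi> F) z) =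
        scaleW (base (par i) powi n) (\<psi> (facop scaleV par X a i F (\<lambda>k. z (\<pi> k))))"
        by (simp only: facop_def \<Phi>_def upd l.scale) (simp add: par)
    qed (auto simp: \<pi>' \<pi>(2) \<pi>'r)
    then show "\<Phi> (fun_act r par scaleV actV x F) z = fun_act r qar scaleW actW x (\<Phi> F) z"
      by (simp add: \<Phi>_def fun_act_def lin_ext_def l.add l.sum l.scale \<psi>(4))
  qed
  ultimately show ?thesis
    unfolding gca_iso_def fun_struct_def
    by (intro exI[of _ \<Phi>]) (simp add: \<Phi>_def l.add l.scale)
qed

section \<open>The isomorphism theorem\<close>

text \<open>The parameters of the factors of the tensor product, the first \<open>m1\<close> of which are of type \<open>\<Omega>\<close>.\<close>
definition params :: "nat \<Rightarrow> (nat \<Rightarrow> complex) \<Rightarrow> (nat \<Rightarrow> complex) \<Rightarrow> (nat \<Rightarrow> complex) \<Rightarrow> nat \<Rightarrow> param" where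
  "params m1 lam sig eta i = (i < m1, lam (Suc i), sig (Suc i), eta (Suc i))"

text \<open>The parameter sets of the two types of factors, recovered from the set of all parameters.\<close>
lemma params_fibers:
  "{(lam k, sig k, eta k) | k. 1 \<le> k \<and> k \<le> m1} = {q. (True, q) \<in> params m1 lam sig eta ` {..<m1 + m2}}"
  "{(lam k, sig k, eta k) | k. m1 + 1 \<le> k \<and> k \<le> m1 + m2} = {q. (False, q) \<in> params m1 lam sig eta ` {..<m1 + m2}}"
proof -
  have "(\<exists>k. P k \<and> 1 \<le> k \<and> k \<le> m1) \<longleftrightarrow> (\<exists>i<m1 + m2. P (Suc i) \<and> i < m1)" for P
  proof
    assume "\<exists>k. P k \<and> 1 \<le> k \<and> k \<le> m1"
    then obtain k where "P k" "1 \<le> k" "k \<le> m1" by blast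
    then show "\<exists>i<m1 + m2. P (Suc i) \<and> i < m1" by (intro exI[of _ "k - 1"]) auto
  qed auto
  then show "{(lam k, sig k, eta k) | k. 1 \<le> k \<and> k \<le> m1} = {q. (True, q) \<in> params m1 lam sig eta ` {..<m1 + m2}}"
    by (auto simp: params_def image_iff)
  have "(\<exists>k. P k \<and> m1 + 1 \<le> k \<and> k \<le> m1 + m2) \<longleftrightarrow> (\<exists>i<m1 + m2. P (Suc i) \<and> \<not> i < m1)" for P
  proof
    assume "\<exists>k. P k \<and> m1 + 1 \<le> k \<and> k \<le> m1 + m2"
    then obtain k where "P k" "m1 + 1 \<le> k" "k \<le> m1 + m2" by blast
    then show "\<exists>i<m1 + m2. P (Suc i) \<and> \<not> i < m1" by (intro exI[of _ "k - 1"]) auto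
  qed (auto intro: exI[of _ "Suc _"])
  then show "{(lam k, sig k, eta k) | k. m1 + 1 \<le> k \<and> k \<le> m1 + m2} = {q. (False, q) \<in> params m1 lam sig eta ` {..<m1 + m2}}"
    by (auto simp: params_def image_iff)
qed

lemma card_param_sets:
  assumes "inj_on lam {1..m1 + m2 :: nat}"
  shows "card {(lam k, sig k, eta k) | k. 1 \<le> k \<and> k \<le> m1} = m1"
    and "card {(lam k, sig k, eta k) | k. m1 + 1 \<le> k \<and> k \<le> m1 + m2} = m2"
proof -
  have *: "inj_on (\<lambda>k. (lam k, sig k, eta k)) A" if "A \<subseteq> {1..m1 + m2}" for A
    using inj_on_subset[OF assms that] by (auto simp: inj_on_def)
  have "{(lam k, sig k, eta k) | k. 1 \<le> k \<and> k \<le> m1} = (\<lambda>k. (lam k, sig k, eta k)) ` {1..m1}" by auto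
  then show "card {(lam k, sig k, eta k) | k. 1 \<le> k \<and> k \<le> m1} = m1"
    by (simp add: card_image[OF *])
  have "{(lam k, sig k, eta k) | k. m1 + 1 \<le> k \<and> k \<le> m1 + m2} = (\<lambda>k. (lam k, sig k, eta k)) ` {m1 + 1..m1 + m2}"
    by auto
  then show "card {(lam k, sig k, eta k) | k. m1 + 1 \<le> k \<and> k \<le> m1 + m2} = m2"
    by (simp add: card_image[OF *])
qed

lemma inj_on_base_params:
  assumes "inj_on lam {1..m}"
  shows "inj_on (\<lambda>i. base (params m1 lam sig eta i)) {..<m}"
proof (rule inj_onI)
  fix i j assume "i \<in> {..<m}" "j \<in> {..<m}" "base (params m1 lam sig eta i) = base (params m1 lam sig eta j)"
  with inj_onD[OF assms, of "Suc i" "Suc j"] show "i = j"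
    by (simp add: params_def base_def)
qed

text \<open>Two injective enumerations of the same finite set differ by a permutation of the indices, extended
  to all natural numbers.\<close>
lemma ex_matching_bij:
  assumes "inj_on p {..<r :: nat}" "inj_on q {..<r}" "p ` {..<r} = q ` {..<r}"
  obtains \<pi> where "bij \<pi>" "\<And>i. \<pi> i < r \<longleftrightarrow> i < r" "\<And>i. i < r \<Longrightarrow> p i = q (\<pi> i)"
proof -
  define \<pi> where "\<pi> i = (if i < r then inv_into {..<r} q (p i) else i)" for i
  define \<pi>' where "\<pi>' i = (if i < r then inv_into {..<r} p (q i) else i)" for i
  have \<pi>: "\<pi> i < r" "q (\<pi> i) = p i" if "i < r" for i
    using inv_into_into[of "p i" q "{..<r}"] f_inv_into_f[of "p i" q "{..<r}"] assms(3) that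
    by (auto simp: \<pi>_def)
  have \<pi>': "\<pi>' i < r" "p (\<pi>' i) = q i" if "i < r" for i
    using inv_into_into[of "q i" p "{..<r}"] f_inv_into_f[of "q i" p "{..<r}"] assms(3) that
    by (auto simp: \<pi>'_def)
  have out: "\<pi> i = i" "\<pi>' i = i" if "\<not> i < r" for i
    using that by (simp_all add: \<pi>_def \<pi>'_def)
  have "\<pi>' (\<pi> i) = i" for i
    using \<pi> \<pi>' out inj_onD[OF assms(1)] by (metis lessThan_iff)
  moreover have "\<pi> (\<pi>' i) = i" for i
    using \<pi> \<pi>' out inj_onD[OF assms(2)] by (metis lessThan_iff)
  ultimately have "bij \<pi>" by (metis bij_betw_byWitness subset_UNIV)
  then show ?thesis using that \<pi> out by metis
qed

theorem theorem3p5: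
  fixes m1 m2 n1 n2 :: nat
    and lam sig eta mu tau gam :: "nat \<Rightarrow> complex"
    and scaleV :: "complex \<Rightarrow> 'v::ab_group_add \<Rightarrow> 'v" and actV :: "gca \<Rightarrow> 'v \<Rightarrow> 'v"
    and scaleW :: "complex \<Rightarrow> 'w::ab_group_add \<Rightarrow> 'w" and actW :: "gca \<Rightarrow> 'w \<Rightarrow> 'w"
  assumes "\<forall>k\<in>{1..m1 + m2}. lam k \<noteq> 0 \<and> sig k \<noteq> 0"
    and "inj_on lam {1..m1 + m2}"
    and "\<forall>k\<in>{1..n1 + n2}. mu k \<noteq> 0 \<and> tau k \<noteq> 0"
    and "inj_on mu {1..n1 + n2}"
    and "simple_gca_module scaleV actV" and "restricted_gca_module scaleV actV"
    and "simple_gca_module scaleW actW" and "restricted_gca_module scaleW actW"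
  shows "gca_iso (T_module (m1, m2) lam sig eta scaleV actV)
                 (T_module (n1, n2) mu tau gam scaleW actW) \<longleftrightarrow>
         (m1, m2) = (n1, n2) \<and>
         gca_iso (type_struct scaleV actV) (type_struct scaleW actW) \<and>
         {(lam k, sig k, eta k) | k. 1 \<le> k \<and> k \<le> m1} =
           {(mu k, tau k, gam k) | k. 1 \<le> k \<and> k \<le> m1} \<and>
         {(lam k, sig k, eta k) | k. m1 + 1 \<le> k \<and> k \<le> m1 + m2} =
           {(mu k, tau k, gam k) | k. m1 + 1 \<le> k \<and> k \<le> m1 + m2}"
proof -
  define p q where "p = params m1 lam sig eta" and "q = params n1 mu tau gam"
  define r s where "r = m1 + m2" and "s = n1 + n2"
  have V: "gca_module scaleV actV" and W: "gca_module scaleW actW"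
    using assms(5,7) by (simp_all add: simple_gca_module_def)
  have TV: "T_module (m1, m2) lam sig eta scaleV actV =
      gca_tensor poly2_scale (map (\<lambda>i. pmod (p i)) [0..<r]) scaleV actV"
    unfolding T_module_eq p_def r_def params_def ..
  have TW: "T_module (n1, n2) mu tau gam scaleW actW =
      gca_tensor poly2_scale (map (\<lambda>i. pmod (q i)) [0..<s]) scaleW actW"
    unfolding T_module_eq q_def s_def params_def ..
  note isoV = tensor_iso_fun_struct[OF V, of p r] and isoW = tensor_iso_fun_struct[OF W, of q s]
  have iso_iff: "gca_iso (T_module (m1, m2) lam sig eta scaleV actV) (T_module (n1, n2) mu tau gam scaleW actW) \<longleftrightarrow>
      gca_iso (fun_struct r p scaleV actV) (fun_struct s q scaleW actW)"
    unfolding TV TW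
    using gca_iso_trans[OF gca_iso_trans[OF gca_iso_sym[OF isoV closed_tensor[OF V]]] isoW]
      gca_iso_trans[OF gca_iso_trans[OF isoV] gca_iso_sym[OF isoW closed_tensor[OF W]]] by (rule iffI)
  have inj: "inj_on (\<lambda>i. base (p i)) {..<r}" "inj_on (\<lambda>i. base (q i)) {..<s}"
    unfolding p_def q_def r_def s_def by (intro inj_on_base_params assms)+
  have nz: "base (p i) \<noteq> 0" "weight (p i) \<noteq> 0" if "i < r" for i
    using assms(1) that by (auto simp: p_def r_def params_def base_def weight_def)
  have nz': "base (q i) \<noteq> 0" "weight (q i) \<noteq> 0" if "i < s" for i
    using assms(3) that by (auto simp: q_def s_def params_def base_def weight_def)
  note fibV = params_fibers[of lam sig eta m1 m2, folded p_def]
  note fibW = params_fibers[of mu tau gam n1 n2, folded q_def]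
  note cards = card_param_sets[OF assms(2), of sig eta] card_param_sets[OF assms(4), of tau gam]
  have images: "p ` {..<r} = q ` {..<s} \<longleftrightarrow> (m1, m2) = (n1, n2) \<and>
         {(lam k, sig k, eta k) | k. 1 \<le> k \<and> k \<le> m1} =
           {(mu k, tau k, gam k) | k. 1 \<le> k \<and> k \<le> m1} \<and>
         {(lam k, sig k, eta k) | k. m1 + 1 \<le> k \<and> k \<le> m1 + m2} =
           {(mu k, tau k, gam k) | k. m1 + 1 \<le> k \<and> k \<le> m1 + m2}" (is "?L \<longleftrightarrow> ?R")
  proof
    assume ?L
    then have L: "p ` {..<m1 + m2} = q ` {..<n1 + n2}" unfolding r_def s_def .
    have eq:
      "{(lam k, sig k, eta k) | k. 1 \<le> k \<and> k \<le> m1} = {(mu k, tau k, gam k) | k. 1 \<le> k \<and> k \<le> n1}"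
      "{(lam k, sig k, eta k) | k. m1 + 1 \<le> k \<and> k \<le> m1 + m2} =
           {(mu k, tau k, gam k) | k. n1 + 1 \<le> k \<and> k \<le> n1 + n2}"
      by (simp_all only: fibV fibW L)
    with cards have "m1 = n1" "m2 = n2" by simp_all
    with eq show ?R by simp
  next
    assume R: ?R
    then have mn: "n1 = m1" "n2 = m2" by simp_all
    have
      "{(lam k, sig k, eta k) | k. 1 \<le> k \<and> k \<le> m1} = {(mu k, tau k, gam k) | k. 1 \<le> k \<and> k \<le> n1}"
      "{(lam k, sig k, eta k) | k. m1 + 1 \<le> k \<and> k \<le> m1 + m2} =
           {(mu k, tau k, gam k) | k. n1 + 1 \<le> k \<and> k \<le> n1 + n2}"
      unfolding mn by (rule R[THEN conjunct2, THEN conjunct1], rule R[THEN conjunct2, THEN conjunct2])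
    then have "{a. (True, a) \<in> p ` {..<r}} = {a. (True, a) \<in> q ` {..<s}}"
      "{a. (False, a) \<in> p ` {..<r}} = {a. (False, a) \<in> q ` {..<s}}"
      unfolding fibV fibW r_def s_def .
    then have iff: "(b, a) \<in> p ` {..<r} \<longleftrightarrow> (b, a) \<in> q ` {..<s}" for b a
      by (cases b) (simp_all only: set_eq_iff mem_Collect_eq)
    show ?L
    proof (rule set_eqI)
      show "x \<in> p ` {..<r} \<longleftrightarrow> x \<in> q ` {..<s}" for x
        using iff[of "fst x" "snd x"] by (simp only: prod.collapse)
    qed
  qed
  show ?thesis
  proof
    assume "gca_iso (T_module (m1, m2) lam sig eta scaleV actV) (T_module (n1, n2) mu tau gam scaleW actW)"
    then have "gca_iso (fun_struct r p scaleV actV) (fun_struct s q scaleW actW)"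
      unfolding iso_iff .
    then obtain f where f: "bij_betw f (polyfuns r scaleV) (polyfuns s scaleW)"
      "\<forall>F\<in>polyfuns r scaleV. \<forall>G\<in>polyfuns r scaleV. f (\<lambda>z. F z + G z) = (\<lambda>z. f F z + f G z)"
      "\<forall>c. \<forall>F\<in>polyfuns r scaleV. f (\<lambda>z. scaleV c (F z)) = (\<lambda>z. scaleW c (f F z))"
      "\<forall>x. \<forall>F\<in>polyfuns r scaleV. f (fun_act r p scaleV actV x F) = fun_act s q scaleW actW x (f F)"
      unfolding gca_iso_def fun_struct_def by auto
    interpret fun_iso scaleV actV scaleW actW r s p q f
    proof (rule fun_iso.intro[OF V W fun_iso_axioms.intro])
      show "f (\<lambda>z. F z + G z) = (\<lambda>z. f F z + f G z)"
        if "F \<in> polyfuns r scaleV" "G \<in> polyfuns r scaleV" for F G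
        using f(2) that by blast
      show "f (\<lambda>z. scaleV c (F z)) = (\<lambda>z. scaleW c (f F z))" if "F \<in> polyfuns r scaleV" for F c
        using f(3) that by blast
      show "f (fun_act r p scaleV actV x F) = fun_act s q scaleW actW x (f F)"
        if "F \<in> polyfuns r scaleV" for F x
        using f(4) that by blast
      show "base (p i) \<noteq> 0" "weight (p i) \<noteq> 0" if "i < r" for i
        by (rule nz[OF that])+
      show "base (q i) \<noteq> 0" "weight (q i) \<noteq> 0" if "i < s" for i
        by (rule nz'[OF that])+
    qed (rule assms(6) assms(8) inj f(1))+
    obtain v :: 'v where v: "v \<noteq> 0" using assms(5) unfolding simple_gca_module_def by blast
    obtain w :: 'w where w: "w \<noteq> 0" using assms(7) unfolding simple_gca_module_def by blast
    from image_par_eq[OF v w] iso_type_struct[OF v assms(7)] show "(m1, m2) = (n1, n2) \<and>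
         gca_iso (type_struct scaleV actV) (type_struct scaleW actW) \<and>
         {(lam k, sig k, eta k) | k. 1 \<le> k \<and> k \<le> m1} =
           {(mu k, tau k, gam k) | k. 1 \<le> k \<and> k \<le> m1} \<and>
         {(lam k, sig k, eta k) | k. m1 + 1 \<le> k \<and> k \<le> m1 + m2} =
           {(mu k, tau k, gam k) | k. m1 + 1 \<le> k \<and> k \<le> m1 + m2}"
      unfolding images by blast
  next
    assume R: "(m1, m2) = (n1, n2) \<and>
         gca_iso (type_struct scaleV actV) (type_struct scaleW actW) \<and>
         {(lam k, sig k, eta k) | k. 1 \<le> k \<and> k \<le> m1} =
           {(mu k, tau k, gam k) | k. 1 \<le> k \<and> k \<le> m1} \<and>
         {(lam k, sig k, eta k) | k. m1 + 1 \<le> k \<and> k \<le> m1 + m2} =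
           {(mu k, tau k, gam k) | k. m1 + 1 \<le> k \<and> k \<le> m1 + m2}"
    then have VW: "gca_iso (type_struct scaleV actV) (type_struct scaleW actW)"
      and img: "p ` {..<r} = q ` {..<s}" unfolding images by blast+
    from R have rs: "s = r" by (simp add: r_def s_def)
    have "inj_on p {..<r}" "inj_on q {..<r}"
      using inj unfolding rs inj_on_def by metis+
    then obtain \<pi> where "bij \<pi>" "\<And>i. \<pi> i < r \<longleftrightarrow> i < r" "\<And>i. i < r \<Longrightarrow> p i = q (\<pi> i)"
      using ex_matching_bij img unfolding rs by metis
    then have "gca_iso (fun_struct r p scaleV actV) (fun_struct r q scaleW actW)"
      by (rule fun_struct_iso_reindex[OF V W VW])
    then show "gca_iso (T_module (m1, m2) lam sig eta scaleV actV) (T_module (n1, n2) mu tau gam scaleW actW)"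
      unfolding iso_iff rs .
  qed
qed

end
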